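(* Let $M$ be a von Neumann algebra with a faithful normal state $\varphi$, let $n\ge 1$, let $V\in\mathcal{P}=\mathbb{C}\langle t_1,\dots,t_n\rangle$ be any potential, and let $X=(x_1,\dots,x_n)\in M^n$ be any $n$-tuple of self-adjoint elements such that $\varphi([\mathcal{D}V](X))=(0,\dots,0)$, i.e. $\varphi([\mathcal{D}_iV](X))=0$ for $i=1,\dots,n$. Then there exists a free Stein kernel for $X$ relative to $V$, i.e. an element $A\in L^2(M_n(M\bar\otimes M^{op}),(\varphi\otimes\varphi^{op})\circ \mathrm{Tr})$ such that for every $P\in\mathcal{P}^n$ $$\langle [\mathcal{D}V](X),P(X)\rangle_\varphi=\langle A,[\mathcal{J}P](X)\rangle_{(\varphi\otimes\varphi^{op})\circ \mathrm{Tr}}.$$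
   Context: $\mathcal{P}=\mathbb{C}\langle t_1,\dots,t_n\rangle$ is the algebra of noncommutative polynomials, with antilinear involution determined by $(PQ)^*=Q^*P^*$, $t_i^*=t_i$. The noncommutative derivatives $\partial_i:\mathcal{P}\to\mathcal{P}\otimes\mathcal{P}$ are the unique linear maps with $\partial_i(t_j)=\delta_{ij}\,1\otimes 1$ and $\partial_i(PQ)=\partial_i(P)\cdot Q+P\cdot\partial_i(Q)$, where $P_1\cdot(Q_1\otimes Q_2)\cdot P_2=(P_1Q_1)\otimes(Q_2P_2)$. The cyclic derivatives are $\mathcal{D}_i=m\circ\sigma\circ\partial_i$ with $\sigma(P\otimes Q)=Q\otimes P$, $m(P\otimes Q)=PQ$; the cyclic gradient of $V$ is $\mathcal{D}V=(\mathcal{D}_1V,\dots,\mathcal{D}_nV)\in\mathcal{P}^n$. For $P=(P_1,\dots,P_n)\in\mathcal{P}^n$ the Jacobian matrix is $\mathcal{J}P=(\partial_jP_i)_{i,j=1}^n\in M_n(\mathcal{P}\otimes\mathcal{P})$. Evaluation at $X$: $P(X)\in M$ is obtained by substituting $t_i\mapsto x_i$; elements of $\mathcal{P}\otimes\mathcal{P}$ are evaluated in each leg and viewed in $M\otimes M^{op}$ ($M^{op}$ is $M$ with opposite multiplication, $\varphi^{op}$ is $\varphi$ viewed as a state on $M^{op}$); tuples and matrices are evaluated entrywise. Inner products: $\langle X,Y\rangle_\varphi=\sum_{i=1}^n\varphi(x_iy_i^* )$ on $M^n$, and $\langle A,B\rangle_{(\varphi\otimes\varphi^{op})\circ \mathrm{Tr}}=\sum_{i,j=1}^n(\varphi\otimes\varphi^{op})(a_{i,j}\cdot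 b_{i,j}^* )$ for matrices over $M\otimes M^{op}$, where $(a\otimes b)^*=a^*\otimes b^*$ and $\cdot$ is the product of $M\otimes M^{op}$. The space $L^2(M_n(M\bar\otimes M^{op}),(\varphi\otimes\varphi^{op})\circ \mathrm{Tr})$ is the Hilbert space completion with respect to the latter inner product ($\mathrm{Tr}$ is the unnormalized trace, $\bar\otimes$ the von Neumann algebra tensor product). *)

theory Defs
  imports "HOL-Analysis.Analysis" "HOL-Library.Poly_Mapping"
begin

section \<open>Complex vector spaces and complex Hilbert spaces\<close>

class scaleC =
  fixes scaleC :: "complex \<Rightarrow> 'a \<Rightarrow> 'a"  (infixr \<open>*\<^sub>C\<close> 75)

class complex_vector = scaleC + ab_group_add +
  assumes scaleC_add_right: "c *\<^sub>C (x + y) = c *\<^sub>C x + c *\<^sub>C y"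
    and scaleC_add_left: "(c + d) *\<^sub>C x = c *\<^sub>C x + d *\<^sub>C x"
    and scaleC_scaleC: "c *\<^sub>C (d *\<^sub>C x) = (c * d) *\<^sub>C x"
    and scaleC_one: "1 *\<^sub>C x = x"

text \<open>The inner product is linear in the first and antilinear in the second argument.\<close>

class chilbert_space = complex_vector + real_inner + complete_space +
  fixes cinner :: "'a \<Rightarrow> 'a \<Rightarrow> complex"
  assumes scaleR_scaleC: "r *\<^sub>R x = complex_of_real r *\<^sub>C x"
    and cinner_add_left: "cinner (x + y) z = cinner x z + cinner y z"
    and cinner_scaleC_left: "cinner (c *\<^sub>C x) y = c * cinner x y"
    and cinner_commute: "cinner x y = cnj (cinner y x)"
    and inner_cinner: "inner x y = Re (cinner x y)"

lemma scaleC_zero_right [simp]: "c *\<^sub>C (0 :: 'a :: complex_vector) = 0"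
  using scaleC_add_right[of c 0 0] by simp

lemma scaleC_zero_left [simp]: "0 *\<^sub>C (x :: 'a :: complex_vector) = 0"
  using scaleC_add_left[of 0 0 x] by simp

lemma scaleC_sum_right:
  "c *\<^sub>C sum f A = (\<Sum>x\<in>A. c *\<^sub>C (f x :: 'a :: complex_vector))"
  by (induction A rule: infinite_finite_induct) (auto simp: scaleC_add_right)

lemma scaleC_minus_right: "c *\<^sub>C (- x :: 'a :: complex_vector) = - (c *\<^sub>C x)"
  using scaleC_add_right[of c x "- x"] by (simp add: eq_neg_iff_add_eq_0 add.commute)

lemma scaleC_diff_right: "c *\<^sub>C (x - y :: 'a :: complex_vector) = c *\<^sub>C x - c *\<^sub>C y"
  using scaleC_add_right[of c x "- y"] by (simp add: scaleC_minus_right)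

lemma cinner_scaleC_right: "cinner x (c *\<^sub>C y) = cnj c * cinner x y"
  by (metis cinner_commute cinner_scaleC_left complex_cnj_mult)

lemma cinner_add_right: "cinner x (y + z) = cinner x y + cinner x z"
  by (metis cinner_commute cinner_add_left complex_cnj_add)

lemma cinner_conv_inner:
  "cinner x y = Complex (inner x y) (- inner (\<i> *\<^sub>C x) y)"
  by (simp add: complex_eq_iff inner_cinner cinner_scaleC_left)

lemma norm_scaleC: "norm (c *\<^sub>C (x :: 'a :: chilbert_space)) = cmod c * norm x"
proof -
  have "cinner (c *\<^sub>C x) (c *\<^sub>C x) = of_real ((cmod c)\<^sup>2) * cinner x x"
    by (simp only: cinner_scaleC_left cinner_scaleC_right complex_norm_square mult.assoc)
      (simp add: mult_ac)
  hence "(norm (c *\<^sub>C x))\<^sup>2 = (cmod c * norm x)\<^sup>2"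
    by (simp add: power2_norm_eq_inner inner_cinner power_mult_distrib)
  thus ?thesis by (simp add: power2_eq_iff_nonneg)
qed


section \<open>Bounded operators\<close>

typedef (overloaded) 'h bop =
  "{f :: 'h :: chilbert_space \<Rightarrow> 'h. bounded_linear f \<and> (\<forall>c x. f (c *\<^sub>C x) = c *\<^sub>C f x)}"
  morphisms bop_apply Bop
  by (rule exI[of _ "\<lambda>x. x"]) (simp add: bounded_linear_ident)

setup_lifting type_definition_bop

lemma bop_bounded_linear: "bounded_linear (bop_apply a)"
  and bop_scaleC: "bop_apply a (c *\<^sub>C x) = c *\<^sub>C bop_apply a x"
  using bop_apply[of a] by auto

lemma bop_eqI: "(\<And>x. bop_apply a x = bop_apply b x) \<Longrightarrow> a = b"
  by (metis bop_apply_inject ext)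

text \<open>Only \<open>ring\<close> and \<open>monoid_mult\<close> rather than \<open>ring_1\<close>: the space may be zero.\<close>

instantiation bop :: (chilbert_space) "{ring, monoid_mult, complex_vector}"
begin

lift_definition zero_bop :: "'a bop" is "\<lambda>x. 0"
  by (simp add: bounded_linear_zero)
lift_definition one_bop :: "'a bop" is "\<lambda>x. x"
  by (simp add: bounded_linear_ident)
lift_definition plus_bop :: "'a bop \<Rightarrow> 'a bop \<Rightarrow> 'a bop" is "\<lambda>f g x. f x + g x"
  by (auto intro: bounded_linear_add simp: scaleC_add_right)
lift_definition uminus_bop :: "'a bop \<Rightarrow> 'a bop" is "\<lambda>f x. - f x"
  by (auto intro: bounded_linear_minus simp: scaleC_minus_right)
lift_definition minus_bop :: "'a bop \<Rightarrow> 'a bop \<Rightarrow> 'a bop" is "\<lambda>f g x. f x - g x"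
  by (auto intro: bounded_linear_sub simp: scaleC_diff_right)
lift_definition times_bop :: "'a bop \<Rightarrow> 'a bop \<Rightarrow> 'a bop" is "\<lambda>f g x. f (g x)"
  by (auto intro: bounded_linear_compose)
lift_definition scaleC_bop :: "complex \<Rightarrow> 'a bop \<Rightarrow> 'a bop" is "\<lambda>c f x. c *\<^sub>C f x"
proof (intro conjI allI)
  fix c d :: complex and f :: "'a \<Rightarrow> 'a" and x
  assume "bounded_linear f \<and> (\<forall>c x. f (c *\<^sub>C x) = c *\<^sub>C f x)"
  then interpret f: bounded_linear f + bounded_linear "\<lambda>x. f x" by simp_all
  obtain K where K: "\<And>x. norm (f x) \<le> norm x * K" using f.bounded by auto
  show "bounded_linear (\<lambda>x. c *\<^sub>C f x)"
  proof (rule bounded_linear_intro[where K = "cmod c * K"])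
    fix x show "norm (c *\<^sub>C f x) \<le> norm x * (cmod c * K)"
      using mult_left_mono[OF K[of x] norm_ge_zero[of c]]
      by (simp add: norm_scaleC mult_ac)
  qed (simp_all add: f.add f.scaleR[unfolded scaleR_scaleC] scaleC_add_right scaleR_scaleC
      scaleC_scaleC mult.commute)
qed (auto simp: scaleC_scaleC mult.commute)

instance
proof
  fix a b c :: "'a bop" and x y :: complex
  show "a * b * c = a * (b * c)" by transfer simp
  show "(a + b) * c = a * c + b * c" by transfer simp
  show "a * (b + c) = a * b + a * c"
    by transfer (auto dest: bounded_linear.linear simp: linear_add)
  show "1 * a = a" "a * 1 = a" by (transfer, simp)+
  show "a + b + c = a + (b + c)" "a + b = b + a" "0 + a = a"
    "- a + a = 0" "a - b = a + - b"
    by (transfer, simp add: fun_eq_iff)+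
  show "x *\<^sub>C (a + b) = x *\<^sub>C a + x *\<^sub>C b" by transfer (simp add: scaleC_add_right)
  show "(x + y) *\<^sub>C a = x *\<^sub>C a + y *\<^sub>C a" by transfer (simp add: scaleC_add_left)
  show "x *\<^sub>C (y *\<^sub>C a) = (x * y) *\<^sub>C a" by transfer (simp add: scaleC_scaleC)
  show "1 *\<^sub>C a = a" by transfer (simp add: scaleC_one)
qed

end

definition adj :: "'h :: chilbert_space bop \<Rightarrow> 'h bop" where
  "adj a = (THE b. \<forall>x y. cinner (bop_apply a x) y = cinner x (bop_apply b y))"

definition nonneg_op :: "'h :: chilbert_space bop \<Rightarrow> bool" where
  "nonneg_op a \<longleftrightarrow> (\<forall>x. cinner (bop_apply a x) x \<in> \<real>\<^sub>\<ge>\<^sub>0)"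

definition op_le :: "'h :: chilbert_space bop \<Rightarrow> 'h bop \<Rightarrow> bool" where
  "op_le a b \<longleftrightarrow> nonneg_op (b - a)"


subsection \<open>Existence of adjoints\<close>

lemma riesz_real:
  fixes g :: "'a :: {real_inner, complete_space} \<Rightarrow> real"
  assumes g: "bounded_linear g"
  obtains z where "\<And>x. g x = inner x z"
proof -
  interpret g: bounded_linear g by fact
  obtain K where K: "\<And>x. norm (g x) \<le> norm x * K" using g.bounded by auto
  define J where "J x = inner x x - 2 * g x" for x
  have bdd: "- K\<^sup>2 \<le> J x" for x
  proof -
    have "0 \<le> (norm x - K)\<^sup>2" by simp
    moreover have "g x \<le> norm x * K" using K[of x] by simp
    ultimately show ?thesis
      unfolding J_def power2_norm_eq_inner[symmetric]
      by (simp add: power2_eq_square algebra_simps)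
  qed
  define m where "m = (INF x. J x)"
  have bb: "bdd_below (range J)" using bdd by (auto simp: bdd_below_def)
  have m_le: "m \<le> J x" for x unfolding m_def using bb by (rule cINF_lower) simp
  have "\<exists>x. J x < m + 1 / Suc n" for n
    using cINF_less_iff[OF _ bb, of "m + 1 / Suc n"] unfolding m_def by auto
  then obtain s where s: "\<And>n. J (s n) < m + 1 / Suc n" by metis
  have par: "(norm (x - y))\<^sup>2 = 2 * J x + 2 * J y - 4 * J ((1/2) *\<^sub>R (x + y))" for x y
    by (simp add: J_def power2_norm_eq_inner inner_diff_left inner_diff_right inner_add_left
        inner_add_right g.add g.scaleR inner_commute algebra_simps)
  have close: "(norm (s i - s j))\<^sup>2 \<le> 2 / Suc i + 2 / Suc j" for i j
    using par[of "s i" "s j"] s[of i] s[of j] m_le[of "(1/2) *\<^sub>R (s i + s j)"] by simp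
  have "Cauchy s"
  proof (rule metric_CauchyI)
    fix e :: real assume e: "e > 0"
    obtain N :: nat where N: "4 / e\<^sup>2 < real N" using reals_Archimedean2 by blast
    have "dist (s i) (s j) < e" if ij: "i \<ge> N" "j \<ge> N" for i j
    proof -
      have N0: "real N > 0" using N e by (smt (verit) divide_pos_pos zero_less_power)
      have "2 / real (Suc i) \<le> 2 / N" "2 / real (Suc j) \<le> 2 / N"
        using ij N0 by (auto intro!: divide_left_mono mult_pos_pos)
      hence "(norm (s i - s j))\<^sup>2 \<le> 4 / N" using close[of i j] by simp
      also have "4 / N < e\<^sup>2" using N N0 e by (simp add: field_simps)
      finally show ?thesis using e by (simp add: dist_norm power_less_imp_less_base)
    qed
    thus "\<exists>M. \<forall>m\<ge>M. \<forall>n\<ge>M. dist (s m) (s n) < e" by blast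
  qed
  then obtain z where z: "s \<longlonglongrightarrow> z" using Cauchy_convergent convergent_def by blast
  have "(\<lambda>n. J (s n)) \<longlonglongrightarrow> J z"
    unfolding J_def by (intro tendsto_intros z g.tendsto)
  moreover have "(\<lambda>n. m + 1 / Suc n) \<longlonglongrightarrow> m + 0"
    by (intro tendsto_intros LIMSEQ_Suc[OF lim_1_over_n])
  ultimately have Jz: "J z \<le> m"
    using s by (intro LIMSEQ_le[of "\<lambda>n. J (s n)" "J z" "\<lambda>n. m + 1 / Suc n" m])
      (auto intro: less_imp_le)
  have "g x = inner x z" for x
  proof (rule ccontr)
    define d where "d = inner x z - g x"
    assume "g x \<noteq> inner x z"
    hence d0: "d \<noteq> 0" by (simp add: d_def)
    have x0: "inner x x > 0"
      using d0 by (auto simp: d_def g.zero)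
    define t where "t = - d / inner x x"
    have "J (z + t *\<^sub>R x) = J z + 2 * t * d + t\<^sup>2 * inner x x"
      by (simp add: J_def d_def inner_add_left inner_add_right g.add g.scaleR inner_commute
          power2_eq_square algebra_simps)
    also have "\<dots> = J z - d\<^sup>2 / inner x x"
      using x0 by (simp add: t_def power2_eq_square field_simps)
    also have "\<dots> < J z" using d0 x0 by simp
    finally show False using m_le[of "z + t *\<^sub>R x"] Jz by simp
  qed
  thus ?thesis using that by blast
qed

lemma adj_ex1: "\<exists>!b. \<forall>x y. cinner (bop_apply a x) y = cinner x (bop_apply b y)"
proof -
  interpret a: bounded_linear "bop_apply a" by (rule bop_bounded_linear)
  obtain K where K: "\<And>x. norm (bop_apply a x) \<le> norm x * K" "K > 0"
    using a.pos_bounded by auto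
  have "\<exists>z. \<forall>x. inner (bop_apply a x) y = inner x z" for y
  proof -
    have "bounded_linear (\<lambda>x. inner (bop_apply a x) y)"
      by (rule bounded_linear_compose[OF bounded_linear_inner_left bop_bounded_linear])
    then obtain z where "\<And>x. inner (bop_apply a x) y = inner x z"
      using riesz_real by metis
    thus ?thesis by blast
  qed
  then obtain b where b: "\<And>x y. inner (bop_apply a x) y = inner x (b y)" by metis
  have c: "cinner (bop_apply a x) y = cinner x (b y)" for x y
    by (simp add: cinner_conv_inner bop_scaleC[symmetric] b)
  have eqI: "u = v" if "\<And>x. cinner x u = cinner x v" for u v :: 'a
  proof -
    have "inner x (u - v) = 0" for x
      using that[of x] unfolding inner_diff_right by (simp add: inner_cinner)
    from this[of "u - v"] show ?thesis by simp
  qed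
  have add: "b (x + y) = b x + b y" for x y
    by (rule eqI) (simp add: c[symmetric] cinner_add_right)
  have sc: "b (k *\<^sub>C x) = k *\<^sub>C b x" for k x
    by (rule eqI) (simp add: c[symmetric] cinner_scaleC_right)
  have bd: "norm (b y) \<le> norm y * K" for y
  proof (cases "b y = 0")
    case False
    have "norm (b y) * norm (b y) = inner (b y) (b y)"
      by (simp add: power2_norm_eq_inner[symmetric] power2_eq_square)
    also have "\<dots> = inner (bop_apply a (b y)) y" by (simp add: b)
    also have "\<dots> \<le> norm (bop_apply a (b y)) * norm y" by (rule norm_cauchy_schwarz)
    also have "\<dots> \<le> (norm (b y) * K) * norm y" by (intro mult_right_mono K) auto
    finally show ?thesis using False by (simp add: mult_ac)
  qed (use K in auto)
  have "bounded_linear b"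
    by (rule bounded_linear_intro[OF add _ bd]) (simp add: scaleR_scaleC sc)
  hence B: "bop_apply (Bop b) = b" by (subst Bop_inverse) (auto simp: sc)
  show ?thesis
  proof (rule ex1I[of _ "Bop b"])
    show "\<forall>x y. cinner (bop_apply a x) y = cinner x (bop_apply (Bop b) y)" by (simp add: B c)
    fix b' assume "\<forall>x y. cinner (bop_apply a x) y = cinner x (bop_apply b' y)"
    thus "b' = Bop b" by (intro bop_eqI eqI) (simp add: B c[symmetric])
  qed
qed

lemma cinner_adj: "cinner (bop_apply a x) y = cinner x (bop_apply (adj a) y)"
  using theI'[OF adj_ex1[of a]] unfolding adj_def by blast

lemma adj_unique:
  "(\<And>x y. cinner (bop_apply a x) y = cinner x (bop_apply b y)) \<Longrightarrow> adj a = b"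
  unfolding adj_def by (rule the1_equality[OF adj_ex1]) blast


section \<open>Von Neumann algebras and normal states\<close>

definition commutant :: "'h :: chilbert_space bop set \<Rightarrow> 'h bop set" where
  "commutant S = {b. \<forall>a\<in>S. a * b = b * a}"

text \<open>A set satisfying these two conditions is automatically a unital subalgebra.\<close>

definition von_neumann_algebra :: "'h :: chilbert_space bop set \<Rightarrow> bool" where
  "von_neumann_algebra M \<longleftrightarrow> (\<forall>a\<in>M. adj a \<in> M) \<and> commutant (commutant M) = M"

text \<open>Functionals on \<open>M\<close> are represented by functions on all bounded operators whose values
  outside \<open>M\<close> are irrelevant.\<close>

definition state_on :: "'h :: chilbert_space bop set \<Rightarrow> ('h bop \<Rightarrow> complex) \<Rightarrow> bool" where
  "state_on M \<phi> \<longleftrightarrow>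
     (\<forall>a\<in>M. \<forall>b\<in>M. \<phi> (a + b) = \<phi> a + \<phi> b) \<and>
     (\<forall>c. \<forall>a\<in>M. \<phi> (c *\<^sub>C a) = c * \<phi> a) \<and>
     (\<forall>a\<in>M. nonneg_op a \<longrightarrow> \<phi> a \<in> \<real>\<^sub>\<ge>\<^sub>0) \<and>
     \<phi> 1 = 1"

definition op_lub :: "'h :: chilbert_space bop set \<Rightarrow> 'h bop set \<Rightarrow> 'h bop \<Rightarrow> bool" where
  "op_lub M D s \<longleftrightarrow>
     s \<in> M \<and> (\<forall>a\<in>D. op_le a s) \<and> (\<forall>b\<in>M. (\<forall>a\<in>D. op_le a b) \<longrightarrow> op_le s b)"

text \<open>Normality: suprema of bounded increasing nets of positive elements are preserved; nets are
  given as upward directed sets.\<close>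

definition normal_on :: "'h :: chilbert_space bop set \<Rightarrow> ('h bop \<Rightarrow> complex) \<Rightarrow> bool" where
  "normal_on M \<phi> \<longleftrightarrow>
     (\<forall>D s. D \<subseteq> M \<and> D \<noteq> {} \<and> (\<forall>a\<in>D. nonneg_op a) \<and>
        (\<forall>a\<in>D. \<forall>b\<in>D. \<exists>c\<in>D. op_le a c \<and> op_le b c) \<and> op_lub M D s \<longrightarrow>
        Re (\<phi> s) = (SUP a\<in>D. Re (\<phi> a)))"

definition faithful_on :: "'h :: chilbert_space bop set \<Rightarrow> ('h bop \<Rightarrow> complex) \<Rightarrow> bool" where
  "faithful_on M \<phi> \<longleftrightarrow> (\<forall>a\<in>M. nonneg_op a \<and> \<phi> a = 0 \<longrightarrow> a = 0)"


section \<open>Opposite algebra, tensor product and \<open>L\<^sup>2\<close>-space\<close>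

text \<open>The von Neumann algebra \<open>M\<^sup>o\<^sup>p\<close> is given by a faithful representation \<open>\<rho>\<close> as a von Neumann
  algebra \<open>N\<close> of operators on a Hilbert space, that is, \<open>\<rho> b\<close> stands for \<open>b \<in> M\<close> regarded as an
  element of \<open>M\<^sup>o\<^sup>p\<close>.\<close>

definition opposite_algebra ::
  "'h :: chilbert_space bop set \<Rightarrow> ('h bop \<Rightarrow> 'g :: chilbert_space bop) \<Rightarrow> 'g bop set \<Rightarrow> bool" where
  "opposite_algebra M \<rho> N \<longleftrightarrow>
     von_neumann_algebra N \<and> bij_betw \<rho> M N \<and>
     (\<forall>a\<in>M. \<forall>b\<in>M. \<rho> (a + b) = \<rho> a + \<rho> b) \<and>
     (\<forall>c. \<forall>a\<in>M. \<rho> (c *\<^sub>C a) = c *\<^sub>C \<rho> a) \<and>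
     (\<forall>a\<in>M. \<forall>b\<in>M. \<rho> (a * b) = \<rho> b * \<rho> a) \<and>
     (\<forall>a\<in>M. \<rho> (adj a) = adj (\<rho> a))"

text \<open>The type \<open>'k\<close> together with the bilinear map \<open>t\<close> is the Hilbert space tensor product of \<open>'h\<close>
  and \<open>'g\<close>; these conditions determine it up to a unique unitary. As the set of elementary tensors
  is closed under complex scalars, its real span is its complex span.\<close>

definition hilbert_tensor ::
  "('h :: chilbert_space \<Rightarrow> 'g :: chilbert_space \<Rightarrow> 'k :: chilbert_space) \<Rightarrow> bool" where
  "hilbert_tensor t \<longleftrightarrow>
     (\<forall>x x' y. t (x + x') y = t x y + t x' y) \<and>
     (\<forall>x y y'. t x (y + y') = t x y + t x y') \<and>
     (\<forall>c x y. t (c *\<^sub>C x) y = c *\<^sub>C t x y \<and> t x (c *\<^sub>C y) = c *\<^sub>C t x y) \<and>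
     (\<forall>x y x' y'. cinner (t x y) (t x' y') = cinner x x' * cinner y y') \<and>
     closure (span (range (\<lambda>(x, y). t x y))) = UNIV"

text \<open>The operator \<open>a \<otimes> b\<close> on the Hilbert space tensor product.\<close>

definition tensor_op ::
  "('h :: chilbert_space \<Rightarrow> 'g :: chilbert_space \<Rightarrow> 'k :: chilbert_space) \<Rightarrow>
     'h bop \<Rightarrow> 'g bop \<Rightarrow> 'k bop" where
  "tensor_op t a b = (THE c. \<forall>x y. bop_apply c (t x y) = t (bop_apply a x) (bop_apply b y))"

lemma hilbert_tensorD:
  assumes "hilbert_tensor t"
  shows "t (x + x') y = t x y + t x' y" "t x (y + y') = t x y + t x y'"
    "t (c *\<^sub>C x) y = c *\<^sub>C t x y" "t x (c *\<^sub>C y) = c *\<^sub>C t x y"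
    "cinner (t x y) (t x' y') = cinner x x' * cinner y y'"
    "closure (span (range (\<lambda>(x, y). t x y))) = UNIV"
  using assms unfolding hilbert_tensor_def by blast+

lemma hilbert_tensor_swap: "hilbert_tensor t \<Longrightarrow> hilbert_tensor (\<lambda>y x. t x y)"
proof -
  have "range (\<lambda>(y, x). t x y) = range (\<lambda>(x, y). t x y)"
    by (auto simp: image_iff)
  thus "hilbert_tensor t \<Longrightarrow> hilbert_tensor (\<lambda>y x. t x y)"
    by (simp add: hilbert_tensor_def mult.commute)
qed

definition tsum ::
  "('h \<Rightarrow> 'g \<Rightarrow> 'k :: chilbert_space) \<Rightarrow> ('h :: chilbert_space) bop \<Rightarrow> ('h \<times> 'g) list \<Rightarrow> 'k" where
  "tsum t a ps = (\<Sum>(x, y)\<leftarrow>ps. t (bop_apply a x) y)"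

lemma tsum_simps [simp]:
  "tsum t a [] = 0" "tsum t a ((x, y) # ps) = t (bop_apply a x) y + tsum t a ps"
  "tsum t a (ps @ qs) = tsum t a ps + tsum t a qs"
  by (simp_all add: tsum_def)

lemma bop_add: "bop_apply a (x + y) = bop_apply a x + bop_apply a y"
  by (rule linear_add[OF bounded_linear.linear[OF bop_bounded_linear]])

lemma tsum_scaleC:
  "hilbert_tensor t \<Longrightarrow> tsum t a (map (\<lambda>(x, y). (c *\<^sub>C x, y)) ps) = c *\<^sub>C tsum t a ps"
  by (induction ps) (auto simp: bop_scaleC hilbert_tensorD scaleC_add_right)

lemma bop_one [simp]: "bop_apply 1 x = x"
  by transfer simp

lemma clinear_cinner_zero [simp]: "cinner (0 :: 'a :: chilbert_space) x = 0" "cinner x 0 = 0"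
  by (simp_all add: cinner_conv_inner complex_eq_iff)

lemma cinner_sum_left: "cinner (sum f A) x = (\<Sum>i\<in>A. cinner (f i) x)"
  by (induction A rule: infinite_finite_induct) (simp_all add: cinner_add_left)

lemma cinner_sum_right: "cinner x (sum f A) = (\<Sum>i\<in>A. cinner x (f i))"
  by (induction A rule: infinite_finite_induct) (simp_all add: cinner_add_right)

lemma cinner_self: "cinner x x = of_real ((norm x)\<^sup>2)"
proof -
  have "Im (cinner x x) = 0" using cinner_commute[of x x] by (simp add: complex_eq_iff)
  thus ?thesis by (simp add: complex_eq_iff power2_norm_eq_inner inner_cinner)
qed

lemma tsum_orthonormal:
  assumes t: "hilbert_tensor t"
  shows "\<exists>E f. finite E \<and> (\<forall>e\<in>E. norm e = 1) \<and>
    (\<forall>e\<in>E. \<forall>e'\<in>E. e \<noteq> e' \<longrightarrow> cinner e e' = 0) \<and>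
    (\<forall>a. tsum t a ps = (\<Sum>e\<in>E. t (bop_apply a (f e)) e))"
proof -
  note T = hilbert_tensorD[OF t]
  have t0: "t 0 y = 0" "t x 0 = 0" for x y
    using T(1)[of 0 0 y] T(2)[of x 0 0] by simp_all
  have tsumr: "t x (sum g E) = (\<Sum>e\<in>E. t x (g e))" for x g and E :: "'b set"
    by (induction E rule: infinite_finite_induct) (simp_all add: t0 T)
  show ?thesis
  proof (induction ps)
    case Nil
    show ?case by (rule exI[of _ "{}"]) simp
  next
    case (Cons p ps)
    obtain x y where p: "p = (x, y)" by fastforce
    obtain E f where E: "finite E" "\<forall>e\<in>E. norm e = 1"
        "\<forall>e\<in>E. \<forall>e'\<in>E. e \<noteq> e' \<longrightarrow> cinner e e' = 0"
      and f: "\<And>a. tsum t a ps = (\<Sum>e\<in>E. t (bop_apply a (f e)) e)"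
      using Cons.IH by metis
    define r where "r = y - (\<Sum>e\<in>E. cinner y e *\<^sub>C e)"
    have y: "y = (\<Sum>e\<in>E. cinner y e *\<^sub>C e) + r" by (simp add: r_def)
    have re: "cinner r e = 0" if e: "e \<in> E" for e
    proof -
      have "cinner y e = (\<Sum>d\<in>E. cinner y d * cinner d e) + cinner r e"
        by (subst y) (simp add: cinner_add_left cinner_sum_left cinner_scaleC_left)
      also have "(\<Sum>d\<in>E. cinner y d * cinner d e) = (\<Sum>d\<in>E. if d = e then cinner y e else 0)"
        using E e by (intro sum.cong) (auto simp: cinner_self)
      finally show ?thesis using E e by simp
    qed
    define f' where "f' e = f e + cinner y e *\<^sub>C x" for e
    have split: "tsum t a (p # ps) = (\<Sum>e\<in>E. t (bop_apply a (f' e)) e) + t (bop_apply a x) r" for a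
    proof -
      have "t (bop_apply a x) y = (\<Sum>e\<in>E. cinner y e *\<^sub>C t (bop_apply a x) e) + t (bop_apply a x) r"
        by (subst y) (simp add: T tsumr)
      thus ?thesis
        by (simp add: p f f'_def bop_add bop_scaleC T sum.distrib)
    qed
    show ?case
    proof (cases "r = 0")
      case True
      show ?thesis
        by (rule exI[of _ E], rule exI[of _ f']) (use E True in \<open>simp add: split t0\<close>)
    next
      case False
      define q where "q = complex_of_real (1 / norm r) *\<^sub>C r"
      have q: "norm q = 1" using False by (simp add: q_def norm_scaleC norm_divide)
      have qe: "cinner q e = 0" "cinner e q = 0" if "e \<in> E" for e
        using re[OF that] cinner_commute[of e q]
        by (simp_all add: q_def cinner_scaleC_left)
      have qE: "q \<notin> E" using qe(1)[of q] q by (auto simp: cinner_self)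
      have r: "r = complex_of_real (norm r) *\<^sub>C q"
        using False by (simp add: q_def scaleC_scaleC scaleC_one flip: of_real_mult)
      define f'' where "f'' = f'(q := complex_of_real (norm r) *\<^sub>C x)"
      have tr: "t (bop_apply a x) r = t (bop_apply a (f'' q)) q" for a
        by (subst r) (simp add: f''_def T bop_scaleC)
      have fE: "(\<Sum>e\<in>E. t (bop_apply a (f'' e)) e) = (\<Sum>e\<in>E. t (bop_apply a (f' e)) e)" for a
        using qE by (intro sum.cong) (auto simp: f''_def)
      show ?thesis
        by (rule exI[of _ "insert q E"], rule exI[of _ f''])
          (use E q qe qE in \<open>auto simp: split tr fE add.commute\<close>)
    qed
  qed
qed

lemma tsum_bound:
  assumes t: "hilbert_tensor t" and K: "\<And>x. norm (bop_apply a x) \<le> norm x * K" and K0: "K \<ge> 0"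
  shows "norm (tsum t a ps) \<le> K * norm (tsum t 1 ps)"
proof -
  obtain E f where E: "finite E" "\<forall>e\<in>E. norm e = 1"
      "\<forall>e\<in>E. \<forall>e'\<in>E. e \<noteq> e' \<longrightarrow> cinner e e' = 0"
    and f: "\<forall>a. tsum t a ps = (\<Sum>e\<in>E. t (bop_apply a (f e)) e)"
    using tsum_orthonormal[OF t, of ps] by (elim exE conjE) (rule that)
  have nrm: "(norm (tsum t b ps))\<^sup>2 = (\<Sum>e\<in>E. (norm (bop_apply b (f e)))\<^sup>2)" for b
  proof -
    have "cinner (tsum t b ps) (tsum t b ps) =
      (\<Sum>e\<in>E. \<Sum>e'\<in>E. cinner (bop_apply b (f e)) (bop_apply b (f e')) * cinner e e')"
      by (simp only: f[rule_format] cinner_sum_left cinner_sum_right hilbert_tensorD(5)[OF t])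
        (rule sum.swap)
    also have "\<dots> = (\<Sum>e\<in>E. \<Sum>e'\<in>E. if e = e' then of_real ((norm (bop_apply b (f e)))\<^sup>2) else 0)"
      using E by (intro sum.cong refl) (auto simp: cinner_self)
    also have "\<dots> = of_real (\<Sum>e\<in>E. (norm (bop_apply b (f e)))\<^sup>2)" using E(1) by simp
    finally show ?thesis unfolding cinner_self of_real_eq_iff .
  qed
  have "(norm (tsum t a ps))\<^sup>2 \<le> (\<Sum>e\<in>E. (K * norm (f e))\<^sup>2)"
    unfolding nrm by (intro sum_mono power_mono) (use K in \<open>auto simp: mult.commute\<close>)
  also have "\<dots> = (K * norm (tsum t 1 ps))\<^sup>2"
    by (simp add: power_mult_distrib nrm sum_distrib_left)
  finally show ?thesis by (rule power2_le_imp_le) (use K0 in simp)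
qed

lemma tensor_left_ex:
  assumes t: "hilbert_tensor t"
  shows "\<exists>c. \<forall>x y. bop_apply c (t x y) = t (bop_apply a x) y"
proof -
  note T = hilbert_tensorD[OF t]
  obtain K where K: "\<And>x. norm (bop_apply a x) \<le> norm x * K" "K > 0"
    using bounded_linear.pos_bounded[OF bop_bounded_linear] by blast
  define G where "G = range (\<lambda>ps. (tsum t 1 ps, tsum t a ps))"
  have G_sc: "(c *\<^sub>C u, c *\<^sub>C v) \<in> G" if "(u, v) \<in> G" for c u v
    using that unfolding G_def
    by (auto simp: image_iff) (metis tsum_scaleC[OF t])
  have G: "subspace G"
    unfolding subspace_def
  proof (intro conjI ballI allI)
    show "0 \<in> G" by (auto simp: G_def image_iff zero_prod_def intro: exI[of _ "[]"])
    fix u v assume "u \<in> G" "v \<in> G"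
    then obtain ps qs where "u = (tsum t 1 ps, tsum t a ps)" "v = (tsum t 1 qs, tsum t a qs)"
      by (auto simp: G_def)
    thus "u + v \<in> G" by (auto simp: G_def image_iff intro: exI[of _ "ps @ qs"])
  next
    fix r :: real and u assume "u \<in> G"
    thus "r *\<^sub>R u \<in> G" using G_sc[of "fst u" "snd u" "of_real r"]
      by (simp add: scaleR_prod_def scaleR_scaleC)
  qed
  define H where "H = closure G"
  have H: "subspace H"
    unfolding subspace_def
  proof (intro conjI ballI allI)
    show "0 \<in> H" using subspace_0[OF G] closure_subset[of G] by (auto simp: H_def)
  next
    fix u v assume "u \<in> H" "v \<in> H"
    then obtain r s where "\<And>n. r n \<in> G" "r \<longlonglongrightarrow> u" "\<And>n. s n \<in> G" "s \<longlonglongrightarrow> v"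
      unfolding H_def closure_sequential by metis
    hence "(\<lambda>n. r n + s n) \<longlonglongrightarrow> u + v" "\<And>n. r n + s n \<in> G"
      by (auto intro: tendsto_add subspace_add[OF G])
    thus "u + v \<in> H"
      unfolding H_def closure_sequential by (intro exI[of _ "\<lambda>n. r n + s n"] conjI allI)
  next
    fix k :: real and u assume "u \<in> H"
    then obtain r where "\<And>n. r n \<in> G" "r \<longlonglongrightarrow> u" unfolding H_def closure_sequential by metis
    hence "(\<lambda>n. k *\<^sub>R r n) \<longlonglongrightarrow> k *\<^sub>R u" "\<And>n. k *\<^sub>R r n \<in> G"
      by (auto intro: tendsto_scaleR subspace_scale[OF G])
    thus "k *\<^sub>R u \<in> H"
      unfolding H_def closure_sequential by (intro exI[of _ "\<lambda>n. k *\<^sub>R r n"] conjI allI)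
  qed
  have Hb: "norm (snd p) \<le> K * norm (fst p)" if "p \<in> H" for p
  proof -
    have "closed {p :: 'c \<times> 'c. norm (snd p) \<le> K * norm (fst p)}"
      by (intro closed_Collect_le continuous_intros)
    moreover have "G \<subseteq> {p. norm (snd p) \<le> K * norm (fst p)}"
      unfolding G_def using tsum_bound[OF t, of a K] K by auto
    ultimately have "H \<subseteq> {p. norm (snd p) \<le> K * norm (fst p)}"
      unfolding H_def by (rule closure_minimal[rotated])
    thus ?thesis using that by blast
  qed
  have bl: "bounded_linear (\<lambda>x :: 'c. c *\<^sub>C x)" for c
    by (rule bounded_linear_intro[where K = "cmod c"])
      (simp_all add: scaleC_add_right scaleR_scaleC scaleC_scaleC norm_scaleC mult.commute)
  have H_sc: "(c *\<^sub>C u, c *\<^sub>C v) \<in> H" if uv: "(u, v) \<in> H" for c u v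
  proof -
    obtain s where s: "\<And>n. s n \<in> G" "s \<longlonglongrightarrow> (u, v)"
      using uv unfolding H_def closure_sequential by blast
    have "(\<lambda>n. (c *\<^sub>C fst (s n), c *\<^sub>C snd (s n))) \<longlonglongrightarrow> (c *\<^sub>C fst (u, v), c *\<^sub>C snd (u, v))"
      by (intro tendsto_Pair bounded_linear.tendsto[OF bl] tendsto_fst tendsto_snd s)
    moreover have "(c *\<^sub>C fst (s n), c *\<^sub>C snd (s n)) \<in> G" for n
      using s(1)[of n] by (intro G_sc) simp
    ultimately show ?thesis
      unfolding H_def closure_sequential fst_conv snd_conv
      by (intro exI[of _ "\<lambda>n. (c *\<^sub>C fst (s n), c *\<^sub>C snd (s n))"] conjI allI)
  qed
  have uniq: "v = w" if "(u, v) \<in> H" "(u, w) \<in> H" for u v w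
    using Hb[OF subspace_diff[OF H that]] by simp
  have fstG: "span (range (\<lambda>(x, y). t x y)) \<subseteq> fst ` G"
  proof (rule span_minimal)
    show "subspace (fst ` G)"
      by (rule linear_subspace_image[OF _ G]) (rule bounded_linear.linear[OF bounded_linear_fst])
    show "range (\<lambda>(x, y). t x y) \<subseteq> fst ` G"
    proof clarify
      fix x y
      have "(t x y, t (bop_apply a x) y) \<in> G"
        by (auto simp: G_def image_iff intro!: exI[of _ "[(x, y)]"])
      thus "t x y \<in> fst ` G" by force
    qed
  qed
  have total: "\<exists>v. (z, v) \<in> H" for z
  proof -
    have "z \<in> closure (fst ` G)" using closure_mono[OF fstG] T(6) by auto
    then obtain s where s: "\<And>n. s n \<in> fst ` G" "s \<longlonglongrightarrow> z"
      unfolding closure_sequential by blast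
    have "\<exists>v. (s n, v) \<in> G" for n
      using s(1)[of n] by auto
    then obtain s' where s': "\<And>n. (s n, s' n) \<in> G" by metis
    have "Cauchy s'"
    proof (rule metric_CauchyI)
      fix e :: real assume e: "e > 0"
      have "Cauchy s" using s(2) by (rule LIMSEQ_imp_Cauchy)
      then obtain N where N: "\<And>m n. m \<ge> N \<Longrightarrow> n \<ge> N \<Longrightarrow> dist (s m) (s n) < e / K"
        using metric_CauchyD[of s "e / K"] e K by auto
      have "dist (s' m) (s' n) < e" if "m \<ge> N" "n \<ge> N" for m n
      proof -
        have "(s m - s n, s' m - s' n) \<in> H"
          using subspace_diff[OF G s'[of m] s'[of n]] closure_subset[of G] by (auto simp: H_def)
        hence "dist (s' m) (s' n) \<le> K * dist (s m) (s n)" using Hb by (fastforce simp: dist_norm)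
        also have "\<dots> < e" using N[OF that] K by (simp add: field_simps)
        finally show ?thesis .
      qed
      thus "\<exists>M. \<forall>m\<ge>M. \<forall>n\<ge>M. dist (s' m) (s' n) < e" by blast
    qed
    then obtain v where "s' \<longlonglongrightarrow> v" using Cauchy_convergent convergent_def by blast
    hence "(\<lambda>n. (s n, s' n)) \<longlonglongrightarrow> (z, v)" using s(2) by (intro tendsto_Pair)
    hence "(z, v) \<in> H"
      unfolding H_def closure_sequential
      by (intro exI[of _ "\<lambda>n. (s n, s' n)"] conjI allI s')
    thus ?thesis by blast
  qed
  then obtain g where g: "\<And>z. (z, g z) \<in> H" by metis
  have g_eq: "g z = v" if "(z, v) \<in> H" for z v using uniq[OF g that] .
  have g_add: "g (x + y) = g x + g y" for x y
    by (rule g_eq) (use subspace_add[OF H g[of x] g[of y]] in simp)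
  have g_sc: "g (c *\<^sub>C x) = c *\<^sub>C g x" for c x
    by (rule g_eq[OF H_sc[OF g]])
  have "bounded_linear g"
    by (rule bounded_linear_intro[where K = K])
      (use Hb[OF g] in \<open>simp_all add: g_add g_sc scaleR_scaleC mult.commute\<close>)
  hence B: "bop_apply (Bop g) = g" by (subst Bop_inverse) (auto simp: g_sc)
  have "g (t x y) = t (bop_apply a x) y" for x y
  proof (rule g_eq)
    have "(t x y, t (bop_apply a x) y) \<in> G"
      by (auto simp: G_def image_iff intro!: exI[of _ "[(x, y)]"])
    thus "(t x y, t (bop_apply a x) y) \<in> H" using closure_subset[of G] by (auto simp: H_def)
  qed
  thus ?thesis using B by metis
qed

lemma bop_eqI_tensor:
  assumes t: "hilbert_tensor t" and eq: "\<And>x y. bop_apply c (t x y) = bop_apply d (t x y)"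
  shows "c = d"
proof (rule bop_eqI)
  fix z
  have lin: "linear (bop_apply c)" "linear (bop_apply d)"
    using bop_bounded_linear bounded_linear.linear by blast+
  have "closed {z. bop_apply c z = bop_apply d z}"
    by (intro closed_Collect_eq bounded_linear.continuous_on[OF bop_bounded_linear] continuous_on_id)
  moreover have "span (range (\<lambda>(x, y). t x y)) \<subseteq> {z. bop_apply c z = bop_apply d z}"
  proof
    fix z assume z: "z \<in> span (range (\<lambda>(x, y). t x y))"
    show "z \<in> {z. bop_apply c z = bop_apply d z}"
      by (rule CollectI, rule linear_eq_on_span[OF lin _ z]) (auto simp: eq)
  qed
  ultimately have "closure (span (range (\<lambda>(x, y). t x y))) \<subseteq> {z. bop_apply c z = bop_apply d z}"
    by (rule closure_minimal[rotated])
  thus "bop_apply c z = bop_apply d z" using hilbert_tensorD(6)[OF t] by auto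
qed

lemma tensor_op_ex1:
  assumes t: "hilbert_tensor t"
  shows "\<exists>!c. \<forall>x y. bop_apply c (t x y) = t (bop_apply a x) (bop_apply b y)"
proof (rule ex_ex1I)
  obtain c where c: "\<forall>x y. bop_apply c (t x y) = t (bop_apply a x) y"
    using tensor_left_ex[OF t] by blast
  obtain d where d: "\<forall>y x. bop_apply d (t x y) = t x (bop_apply b y)"
    using tensor_left_ex[OF hilbert_tensor_swap[OF t]] by blast
  have "bop_apply (c * d) z = bop_apply c (bop_apply d z)" for z by transfer simp
  thus "\<exists>c. \<forall>x y. bop_apply c (t x y) = t (bop_apply a x) (bop_apply b y)"
    using c d by (intro exI[of _ "c * d"]) simp
qed (use bop_eqI_tensor[OF t] in \<open>auto intro: bop_eqI_tensor[OF t]\<close>)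

lemma tensor_op_apply:
  "hilbert_tensor t \<Longrightarrow>
     bop_apply (tensor_op t a b) (t x y) = t (bop_apply a x) (bop_apply b y)"
  using theI'[OF tensor_op_ex1[of t a b]] unfolding tensor_op_def by blast

definition vn_tensor ::
  "('h :: chilbert_space \<Rightarrow> 'g :: chilbert_space \<Rightarrow> 'k :: chilbert_space) \<Rightarrow>
     'h bop set \<Rightarrow> 'g bop set \<Rightarrow> 'k bop set" where
  "vn_tensor t M N = commutant (commutant {tensor_op t a b | a b. a \<in> M \<and> b \<in> N})"

text \<open>The state \<open>\<phi> \<otimes> \<phi>\<^sup>o\<^sup>p\<close>: the normal state on the von Neumann algebra tensor product that is
  determined by its values on elementary tensors; \<open>\<phi>\<^sup>o\<^sup>p (\<rho> b) = \<phi> b\<close>.\<close>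

definition product_state ::
  "('h :: chilbert_space \<Rightarrow> 'g :: chilbert_space \<Rightarrow> 'k :: chilbert_space) \<Rightarrow>
     'h bop set \<Rightarrow> ('h bop \<Rightarrow> complex) \<Rightarrow> ('h bop \<Rightarrow> 'g bop) \<Rightarrow> 'g bop set \<Rightarrow>
     ('k bop \<Rightarrow> complex) \<Rightarrow> bool" where
  "product_state t M \<phi> \<rho> N \<psi> \<longleftrightarrow>
     state_on (vn_tensor t M N) \<psi> \<and> normal_on (vn_tensor t M N) \<psi> \<and>
     (\<forall>a\<in>M. \<forall>b\<in>M. \<psi> (tensor_op t a (\<rho> b)) = \<phi> a * \<phi> b)"

definition matrices_over :: "'a set \<Rightarrow> ('a ^ 'n :: finite ^ 'n) set" where
  "matrices_over W = {A. \<forall>i j. A $ i $ j \<in> W}"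

text \<open>The inner product \<open>(\<psi> \<circ> Tr) (A B\<^sup>*)\<close> on matrices.\<close>

definition mat_inner ::
  "('k :: chilbert_space bop \<Rightarrow> complex) \<Rightarrow>
     'k bop ^ 'n :: finite ^ 'n \<Rightarrow> 'k bop ^ 'n ^ 'n \<Rightarrow> complex" where
  "mat_inner \<psi> A B = (\<Sum>i\<in>UNIV. \<Sum>j\<in>UNIV. \<psi> (A $ i $ j * adj (B $ i $ j)))"

definition tuple_inner ::
  "('h :: chilbert_space bop \<Rightarrow> complex) \<Rightarrow> 'h bop ^ 'n :: finite \<Rightarrow> 'h bop ^ 'n \<Rightarrow> complex" where
  "tuple_inner \<phi> X Y = (\<Sum>i\<in>UNIV. \<phi> (X $ i * adj (Y $ i)))"

text \<open>The Hilbert space \<open>'l\<close> with the map \<open>\<iota>\<close> is the completion \<open>L\<^sup>2(M\<^sub>n(W), \<psi> \<circ> Tr)\<close>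
  of \<open>M\<^sub>n(W)\<close>; \<open>\<iota> A\<close> is the class of the matrix \<open>A\<close>.\<close>

definition L2_completion ::
  "'k :: chilbert_space bop set \<Rightarrow> ('k bop \<Rightarrow> complex) \<Rightarrow>
     ('k bop ^ 'n :: finite ^ 'n \<Rightarrow> 'l :: chilbert_space) \<Rightarrow> bool" where
  "L2_completion W \<psi> \<iota> \<longleftrightarrow>
     (\<forall>A \<in> matrices_over W. \<forall>B \<in> matrices_over W. \<iota> (A + B) = \<iota> A + \<iota> B) \<and>
     (\<forall>c. \<forall>A \<in> matrices_over W. \<iota> (\<chi> i j. c *\<^sub>C (A $ i $ j)) = c *\<^sub>C \<iota> A) \<and>
     (\<forall>A \<in> matrices_over W. \<forall>B \<in> matrices_over W. cinner (\<iota> A) (\<iota> B) = mat_inner \<psi> A B) \<and>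
     closure (\<iota> ` matrices_over W) = UNIV"


section \<open>Noncommutative polynomials\<close>

text \<open>Words in the variables form the free monoid, written additively so that the convolution
  product of finitely supported functions is the product of noncommutative polynomials.\<close>

instantiation list :: (type) monoid_add
begin
definition zero_list :: "'a list" where "0 = []"
definition plus_list :: "'a list \<Rightarrow> 'a list \<Rightarrow> 'a list" where "xs + ys = xs @ ys"
instance by standard (simp_all add: zero_list_def plus_list_def)
end

instantiation complex :: complex_vector
begin
definition scaleC_complex :: "complex \<Rightarrow> complex \<Rightarrow> complex" where "scaleC_complex = (*)"
instance by standard (simp_all add: scaleC_complex_def algebra_simps)
end

instantiation poly_mapping :: (type, complex_vector) complex_vector
begin
lift_definition scaleC_poly_mapping :: "complex \<Rightarrow> ('a \<Rightarrow>\<^sub>0 'b) \<Rightarrow> 'a \<Rightarrow>\<^sub>0 'b" is "\<lambda>c f k. c *\<^sub>C f k"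
  by (erule rev_finite_subset) auto
instance
  by standard
    (transfer, simp add: fun_eq_iff scaleC_add_right scaleC_add_left scaleC_scaleC scaleC_one)+
end

text \<open>\<open>'n ncpoly\<close> is the algebra \<open>\<P>\<close> in the variables \<open>t\<^sub>i\<close>, \<open>i :: 'n\<close>, and \<open>'n ncpoly2\<close> is its
  algebraic tensor square \<open>\<P> \<otimes> \<P>\<close>, with the pairs \<open>(u, v)\<close> standing for the basis vectors
  \<open>u \<otimes> v\<close>.  The product of \<open>'n ncpoly2\<close> is \<open>(P\<^sub>1 \<otimes> P\<^sub>2) (Q\<^sub>1 \<otimes> Q\<^sub>2) = (P\<^sub>1 Q\<^sub>1) \<otimes> (P\<^sub>2 Q\<^sub>2)\<close>.\<close>

type_synonym 'n ncpoly = "'n list \<Rightarrow>\<^sub>0 complex"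
type_synonym 'n ncpoly2 = "('n list \<times> 'n list) \<Rightarrow>\<^sub>0 complex"

definition lin_ext :: "('w \<Rightarrow> 'v :: complex_vector) \<Rightarrow> ('w \<Rightarrow>\<^sub>0 complex) \<Rightarrow> 'v" where
  "lin_ext f P = (\<Sum>w\<in>Poly_Mapping.keys P. Poly_Mapping.lookup P w *\<^sub>C f w)"

definition clinear_map :: "('v :: complex_vector \<Rightarrow> 'w :: complex_vector) \<Rightarrow> bool" where
  "clinear_map f \<longleftrightarrow> (\<forall>x y. f (x + y) = f x + f y) \<and> (\<forall>c x. f (c *\<^sub>C x) = c *\<^sub>C f x)"

definition ncvar :: "'n \<Rightarrow> 'n ncpoly" where
  "ncvar i = Poly_Mapping.single [i] 1"

definition nctensor :: "'n ncpoly \<Rightarrow> 'n ncpoly \<Rightarrow> 'n ncpoly2" where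
  "nctensor P Q = lin_ext (\<lambda>u. lin_ext (\<lambda>v. Poly_Mapping.single (u, v) 1) Q) P"

text \<open>The bimodule structure \<open>P\<^sub>1 \<cdot> (Q\<^sub>1 \<otimes> Q\<^sub>2) \<cdot> P\<^sub>2 = (P\<^sub>1 Q\<^sub>1) \<otimes> (Q\<^sub>2 P\<^sub>2)\<close>; see \<open>bimod_nctensor\<close>
  below.\<close>

definition lact :: "'n ncpoly \<Rightarrow> 'n ncpoly2 \<Rightarrow> 'n ncpoly2" where
  "lact P U = nctensor P 1 * U"

definition ract :: "'n ncpoly2 \<Rightarrow> 'n ncpoly \<Rightarrow> 'n ncpoly2" where
  "ract U P = U * nctensor 1 P"

definition is_nc_deriv :: "'n \<Rightarrow> ('n ncpoly \<Rightarrow> 'n ncpoly2) \<Rightarrow> bool" where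
  "is_nc_deriv i D \<longleftrightarrow>
     clinear_map D \<and>
     (\<forall>j. D (ncvar j) = (if i = j then nctensor 1 1 else 0)) \<and>
     (\<forall>P Q. D (P * Q) = ract (D P) Q + lact P (D Q))"

definition nc_deriv :: "'n \<Rightarrow> 'n ncpoly \<Rightarrow> 'n ncpoly2" where
  "nc_deriv i = (THE D. is_nc_deriv i D)"

definition ncflip :: "'n ncpoly2 \<Rightarrow> 'n ncpoly2" where
  "ncflip = lin_ext (\<lambda>(u, v). Poly_Mapping.single (v, u) 1)"

definition ncmult :: "'n ncpoly2 \<Rightarrow> 'n ncpoly" where
  "ncmult = lin_ext (\<lambda>(u, v). Poly_Mapping.single (u @ v) 1)"

definition cyc_deriv :: "'n \<Rightarrow> 'n ncpoly \<Rightarrow> 'n ncpoly" where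
  "cyc_deriv i = ncmult \<circ> ncflip \<circ> nc_deriv i"

definition cyc_grad :: "'n ncpoly \<Rightarrow> 'n ncpoly ^ 'n :: finite" where
  "cyc_grad V = (\<chi> i. cyc_deriv i V)"

definition nc_jacobian :: "'n ncpoly ^ 'n :: finite \<Rightarrow> 'n ncpoly2 ^ 'n ^ 'n" where
  "nc_jacobian P = (\<chi> i j. nc_deriv j (P $ i))"


subsection \<open>Existence and uniqueness of the noncommutative derivatives\<close>

lemma scaleC_single [simp]:
  "c *\<^sub>C Poly_Mapping.single w d = Poly_Mapping.single w (c *\<^sub>C d)"
  by transfer (auto simp: fun_eq_iff when_def)

lemma single_scaleC_1: "Poly_Mapping.single w c = c *\<^sub>C Poly_Mapping.single w (1 :: complex)"
  by (simp add: scaleC_complex_def)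

lemma lookup_scaleC [simp]: "Poly_Mapping.lookup (c *\<^sub>C P) w = c *\<^sub>C Poly_Mapping.lookup P w"
  by transfer simp

lemma lin_ext_superset:
  assumes "finite S" "Poly_Mapping.keys P \<subseteq> S"
  shows "lin_ext f P = (\<Sum>w\<in>S. Poly_Mapping.lookup P w *\<^sub>C f w)"
  unfolding lin_ext_def
  by (rule sum.mono_neutral_left[OF assms]) (auto simp: in_keys_iff)

lemma lin_ext_clinear: "clinear_map (lin_ext f)"
  unfolding clinear_map_def
proof (intro conjI allI)
  fix P Q :: "'a \<Rightarrow>\<^sub>0 complex" and c :: complex
  let ?S = "Poly_Mapping.keys P \<union> Poly_Mapping.keys Q \<union> Poly_Mapping.keys (P + Q)
     \<union> Poly_Mapping.keys (c *\<^sub>C P)"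
  have S: "lin_ext f R = (\<Sum>w\<in>?S. Poly_Mapping.lookup R w *\<^sub>C f w)"
    if "R \<in> {P, Q, P + Q, c *\<^sub>C P}" for R
    using that by (intro lin_ext_superset) auto
  show "lin_ext f (P + Q) = lin_ext f P + lin_ext f Q"
    by (subst (1 2 3) S) (simp_all add: lookup_add scaleC_add_left sum.distrib)
  show "lin_ext f (c *\<^sub>C P) = c *\<^sub>C lin_ext f P"
    by (subst (1 2) S) (simp_all add: scaleC_sum_right scaleC_scaleC scaleC_complex_def)
qed

lemma lin_ext_single [simp]: "lin_ext f (Poly_Mapping.single w c) = c *\<^sub>C f w"
  by (simp add: lin_ext_def)

lemma clinear_zero: "clinear_map f \<Longrightarrow> f 0 = 0"
  unfolding clinear_map_def by (metis add_cancel_right_right)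

lemma clinear_sum: "clinear_map f \<Longrightarrow> f (sum g A) = (\<Sum>x\<in>A. f (g x))"
  by (induction A rule: infinite_finite_induct) (auto simp: clinear_zero clinear_map_def)

lemma lin_ext_ident: "lin_ext (\<lambda>w. Poly_Mapping.single w 1) P = P"
  by (rule poly_mapping_eqI)
    (auto simp: lin_ext_def lookup_sum lookup_single scaleC_complex_def when_def in_keys_iff)

lemma poly_decomp:
  "P = (\<Sum>w\<in>Poly_Mapping.keys P. Poly_Mapping.single w (Poly_Mapping.lookup P w :: complex))"
  using lin_ext_ident[of P] by (simp add: lin_ext_def scaleC_complex_def)

lemma clinear_eqI:
  fixes f g :: "('w \<Rightarrow>\<^sub>0 complex) \<Rightarrow> 'v :: complex_vector"
  assumes f: "clinear_map f" and g: "clinear_map g"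
    and eq: "\<And>w. f (Poly_Mapping.single w 1) = g (Poly_Mapping.single w 1)"
  shows "f P = g P"
proof -
  have "f (c *\<^sub>C Poly_Mapping.single w 1) = g (c *\<^sub>C Poly_Mapping.single w 1)" for c w
    using f g eq[of w] unfolding clinear_map_def by metis
  hence "f (lin_ext (\<lambda>w. Poly_Mapping.single w 1) P) = g (lin_ext (\<lambda>w. Poly_Mapping.single w 1) P)"
    unfolding lin_ext_def clinear_sum[OF f] clinear_sum[OF g] by (simp only:)
  thus ?thesis by (simp only: lin_ext_ident)
qed

lemma scaleC_conv_mult:
  fixes R :: "'a :: monoid_add \<Rightarrow>\<^sub>0 complex"
  shows "c *\<^sub>C R = Poly_Mapping.single 0 c * R" "c *\<^sub>C R = R * Poly_Mapping.single 0 c"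
proof -
  let ?R = "\<Sum>w\<in>Poly_Mapping.keys R. Poly_Mapping.single w (Poly_Mapping.lookup R w)"
  have "c *\<^sub>C ?R = Poly_Mapping.single 0 c * ?R"
    by (simp add: scaleC_sum_right sum_distrib_left mult_single scaleC_complex_def)
  moreover have "c *\<^sub>C ?R = ?R * Poly_Mapping.single 0 c"
    by (simp add: scaleC_sum_right sum_distrib_right mult_single scaleC_complex_def mult.commute)
  ultimately show "c *\<^sub>C R = Poly_Mapping.single 0 c * R" "c *\<^sub>C R = R * Poly_Mapping.single 0 c"
    by (simp_all only: poly_decomp[of R, symmetric])
qed

lemma scaleC_mult_left: "(c *\<^sub>C P) * Q = c *\<^sub>C (P * (Q :: 'a :: monoid_add \<Rightarrow>\<^sub>0 complex))"
  by (simp only: scaleC_conv_mult(1) mult.assoc)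

lemma scaleC_mult_right: "P * (c *\<^sub>C Q) = c *\<^sub>C (P * (Q :: 'a :: monoid_add \<Rightarrow>\<^sub>0 complex))"
  by (simp only: scaleC_conv_mult(2) mult.assoc)

lemma nctensor_single:
  "nctensor (Poly_Mapping.single u c) (Poly_Mapping.single v d) = Poly_Mapping.single (u, v) (c * d)"
  by (simp add: nctensor_def scaleC_complex_def)

lemma one_ncpoly: "(1 :: 'n ncpoly) = Poly_Mapping.single [] 1"
  by (simp add: zero_list_def[symmetric])

lemma clinear_nctensor_left: "clinear_map (\<lambda>P. nctensor P Q)"
  unfolding nctensor_def by (rule lin_ext_clinear)

lemma clinear_nctensor_right:
  fixes P :: "'n ncpoly"
  shows "clinear_map (\<lambda>Q. nctensor P Q)"
proof -
  have "clinear_map (lin_ext (\<lambda>v. Poly_Mapping.single (u, v :: 'n list) (1 :: complex)))" for u :: "'n list"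
    by (rule lin_ext_clinear)
  hence "lin_ext (\<lambda>v. Poly_Mapping.single (u, v) 1) (x + y) =
        lin_ext (\<lambda>v. Poly_Mapping.single (u, v) (1 :: complex)) x +
        lin_ext (\<lambda>v. Poly_Mapping.single (u, v) 1) y"
      "lin_ext (\<lambda>v. Poly_Mapping.single (u, v) 1) (c *\<^sub>C x) =
        c *\<^sub>C lin_ext (\<lambda>v. Poly_Mapping.single (u, v) (1 :: complex)) x"
    for u :: "'n list" and x y :: "'n ncpoly" and c
    unfolding clinear_map_def by blast+
  thus ?thesis
    by (simp add: nctensor_def lin_ext_def[of _ P] clinear_map_def scaleC_add_right
      sum.distrib scaleC_sum_right scaleC_scaleC mult.commute)
qed

lemma nctensor_mult: "nctensor P Q * nctensor P' Q' = nctensor (P * P') (Q * Q')"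
proof -
  note c = clinear_nctensor_left[unfolded clinear_map_def, rule_format]
    clinear_nctensor_right[unfolded clinear_map_def, rule_format]
  note lin = clinear_map_def c distrib_left distrib_right scaleC_mult_left scaleC_mult_right
  let ?s = "\<lambda>w :: 'a list. Poly_Mapping.single w (1 :: complex)"
  have 1: "nctensor (?s u) (?s v) * nctensor (?s u') (?s v') =
      nctensor (?s u * ?s u') (?s v * ?s v')" for u v u' v'
    by (simp add: nctensor_single mult_single)
  have 2: "nctensor (?s u) (?s v) * nctensor (?s u') Q' =
      nctensor (?s u * ?s u') (?s v * Q')" for u v u'
    by (rule clinear_eqI[of "\<lambda>Q'. nctensor (?s u) (?s v) * nctensor (?s u') Q'"
          "\<lambda>Q'. nctensor (?s u * ?s u') (?s v * Q')"]) (simp_all add: lin 1)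
  have 3: "nctensor (?s u) (?s v) * nctensor P' Q' = nctensor (?s u * P') (?s v * Q')" for u v
    by (rule clinear_eqI[of "\<lambda>P'. nctensor (?s u) (?s v) * nctensor P' Q'"
          "\<lambda>P'. nctensor (?s u * P') (?s v * Q')"]) (simp_all add: lin 2)
  have 4: "nctensor (?s u) Q * nctensor P' Q' = nctensor (?s u * P') (Q * Q')" for u
    by (rule clinear_eqI[of "\<lambda>Q. nctensor (?s u) Q * nctensor P' Q'"
          "\<lambda>Q. nctensor (?s u * P') (Q * Q')"]) (simp_all add: lin 3)
  show ?thesis
    by (rule clinear_eqI[of "\<lambda>P. nctensor P Q * nctensor P' Q'"
          "\<lambda>P. nctensor (P * P') (Q * Q')"]) (simp_all add: lin 4)
qed

lemma bimod_nctensor: "ract (lact P\<^sub>1 (nctensor Q\<^sub>1 Q\<^sub>2)) P\<^sub>2 = nctensor (P\<^sub>1 * Q\<^sub>1) (Q\<^sub>2 * P\<^sub>2)"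
  by (simp add: lact_def ract_def nctensor_mult)

fun word_deriv :: "'n \<Rightarrow> 'n list \<Rightarrow> 'n ncpoly2" where
  "word_deriv i [] = 0"
| "word_deriv i (j # w) =
     (if i = j then Poly_Mapping.single ([], w) 1 else 0)
     + Poly_Mapping.single ([j], []) 1 * word_deriv i w"

lemma word_deriv_append:
  "word_deriv i (u @ v) =
     word_deriv i u * Poly_Mapping.single ([], v) 1 + Poly_Mapping.single (u, []) 1 * word_deriv i v"
proof (induction u)
  case Nil
  have "Poly_Mapping.single ([], []) 1 = (1 :: 'a ncpoly2)"
    by (simp add: zero_list_def[symmetric] zero_prod_def[symmetric])
  thus ?case by simp
next
  case (Cons j u)
  have 1: "Poly_Mapping.single (j # u, []) (1 :: complex) =
      Poly_Mapping.single ([j], []) 1 * Poly_Mapping.single (u, []) 1"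
    by (simp add: mult_single plus_list_def)
  have 2: "Poly_Mapping.single ([], u @ v) (1 :: complex) =
      Poly_Mapping.single ([], u) 1 * Poly_Mapping.single ([], v) 1"
    by (simp add: mult_single plus_list_def)
  show ?case
    unfolding append_Cons word_deriv.simps Cons.IH 1 2
    by (simp add: distrib_left distrib_right mult.assoc add.assoc)
qed

lemma is_nc_deriv_word_deriv: "is_nc_deriv i (lin_ext (word_deriv i))"
  unfolding is_nc_deriv_def
proof (intro conjI allI)
  let ?D = "lin_ext (word_deriv i)"
  show D: "clinear_map ?D" by (rule lin_ext_clinear)
  show "?D (ncvar j) = (if i = j then nctensor 1 1 else 0)" for j
    by (simp add: ncvar_def one_ncpoly nctensor_single scaleC_one)
  note c = clinear_nctensor_left[unfolded clinear_map_def, rule_format]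
    clinear_nctensor_right[unfolded clinear_map_def, rule_format]
    D[unfolded clinear_map_def, rule_format]
  note lin = clinear_map_def c distrib_left distrib_right scaleC_mult_left scaleC_mult_right
    lact_def ract_def scaleC_add_right scaleC_one
  let ?s = "\<lambda>w :: 'a list. Poly_Mapping.single w (1 :: complex)"
  have 1: "?D (?s u * ?s v) = ract (?D (?s u)) (?s v) + lact (?s u) (?D (?s v))" for u v
    unfolding lact_def ract_def one_ncpoly nctensor_single
    by (simp add: mult_single plus_list_def word_deriv_append scaleC_one)
  have 2: "?D (?s u * Q) = ract (?D (?s u)) Q + lact (?s u) (?D Q)" for u Q
    by (rule clinear_eqI[of "\<lambda>Q. ?D (?s u * Q)"
          "\<lambda>Q. ract (?D (?s u)) Q + lact (?s u) (?D Q)"]) (use 1 in \<open>simp_all add: lin\<close>)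
  show "?D (P * Q) = ract (?D P) Q + lact P (?D Q)" for P Q
    by (rule clinear_eqI[of "\<lambda>P. ?D (P * Q)"
          "\<lambda>P. ract (?D P) Q + lact P (?D Q)"]) (use 2 in \<open>simp_all add: lin\<close>)
qed

lemma nc_deriv_ex1: "\<exists>!D. is_nc_deriv i D"
proof (rule ex_ex1I)
  show "\<exists>D. is_nc_deriv i D" by (rule exI, rule is_nc_deriv_word_deriv)
next
  fix D E assume D: "is_nc_deriv i D" and E: "is_nc_deriv i E"
  have one: "F 1 = 0" if "is_nc_deriv i F" for F
  proof -
    have "F (1 * 1) = ract (F 1) 1 + lact 1 (F 1)"
      using that unfolding is_nc_deriv_def by blast
    moreover have "nctensor 1 1 = (1 :: 'a ncpoly2)"
      unfolding one_ncpoly nctensor_single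
      by (simp add: zero_list_def[symmetric] zero_prod_def[symmetric])
    ultimately show ?thesis by (simp add: lact_def ract_def)
  qed
  have w: "D (Poly_Mapping.single w 1) = E (Poly_Mapping.single w 1)" for w
  proof (induction w)
    case Nil
    show ?case using one[OF D] one[OF E] by (simp add: one_ncpoly)
  next
    case (Cons j w)
    have "Poly_Mapping.single (j # w) 1 = ncvar j * Poly_Mapping.single w (1 :: complex)"
      by (simp add: ncvar_def mult_single plus_list_def)
    thus ?case using D E Cons.IH by (simp add: is_nc_deriv_def)
  qed
  show "D = E"
    by (rule ext, rule clinear_eqI[of D E]) (use D E w in \<open>auto simp: is_nc_deriv_def\<close>)
qed

lemma is_nc_deriv_nc_deriv: "is_nc_deriv i (nc_deriv i)"
  unfolding nc_deriv_def by (rule theI'[OF nc_deriv_ex1])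


section \<open>Evaluation and free Stein kernels\<close>

definition eval_word :: "'h :: chilbert_space bop ^ 'n :: finite \<Rightarrow> 'n list \<Rightarrow> 'h bop" where
  "eval_word X w = prod_list (map (\<lambda>i. X $ i) w)"

definition nc_eval :: "'h :: chilbert_space bop ^ 'n :: finite \<Rightarrow> 'n ncpoly \<Rightarrow> 'h bop" where
  "nc_eval X = lin_ext (eval_word X)"

definition nc_eval_tuple ::
  "'h :: chilbert_space bop ^ 'n :: finite \<Rightarrow> 'n ncpoly ^ 'n \<Rightarrow> 'h bop ^ 'n" where
  "nc_eval_tuple X P = (\<chi> i. nc_eval X (P $ i))"

text \<open>Both legs are evaluated in \<open>M\<close>; the second value is then regarded as an element of
  \<open>M\<^sup>o\<^sup>p\<close> by means of \<open>\<rho>\<close>.\<close>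

definition nc_eval2 ::
  "('h :: chilbert_space \<Rightarrow> 'g :: chilbert_space \<Rightarrow> 'k :: chilbert_space) \<Rightarrow>
     ('h bop \<Rightarrow> 'g bop) \<Rightarrow> 'h bop ^ 'n :: finite \<Rightarrow> 'n ncpoly2 \<Rightarrow> 'k bop" where
  "nc_eval2 t \<rho> X = lin_ext (\<lambda>(u, v). tensor_op t (eval_word X u) (\<rho> (eval_word X v)))"

definition nc_eval2_mat ::
  "('h :: chilbert_space \<Rightarrow> 'g :: chilbert_space \<Rightarrow> 'k :: chilbert_space) \<Rightarrow>
     ('h bop \<Rightarrow> 'g bop) \<Rightarrow> 'h bop ^ 'n :: finite \<Rightarrow> 'n ncpoly2 ^ 'n ^ 'n \<Rightarrow> 'k bop ^ 'n ^ 'n" where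
  "nc_eval2_mat t \<rho> X A = (\<chi> i j. nc_eval2 t \<rho> X (A $ i $ j))"

definition free_stein_kernel ::
  "('h :: chilbert_space \<Rightarrow> 'g :: chilbert_space \<Rightarrow> 'k :: chilbert_space) \<Rightarrow>
     ('h bop \<Rightarrow> 'g bop) \<Rightarrow> ('h bop \<Rightarrow> complex) \<Rightarrow>
     ('k bop ^ 'n :: finite ^ 'n \<Rightarrow> 'l :: chilbert_space) \<Rightarrow>
     'h bop ^ 'n \<Rightarrow> 'n ncpoly \<Rightarrow> 'l \<Rightarrow> bool" where
  "free_stein_kernel t \<rho> \<phi> \<iota> X V A \<longleftrightarrow>
     (\<forall>P. tuple_inner \<phi> (nc_eval_tuple X (cyc_grad V)) (nc_eval_tuple X P) =
          cinner A (\<iota> (nc_eval2_mat t \<rho> X (nc_jacobian P))))"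

end

theory Submission
  imports Defs
begin

text \<open>
  The kernel is given by an explicit formula. Write \<open>T\<^sub>j = x\<^sub>j \<otimes> 1 - 1 \<otimes> x\<^sub>j\<close> in
  \<open>M \<otimes> M\<^sup>o\<^sup>p\<close>. The noncommutative derivatives act as a difference quotient: for every
  noncommutative polynomial \<open>P\<close>,
    \<open>\<Sum>\<^sub>j [\<partial>\<^sub>jP](X) \<cdot> T\<^sub>j = P(X) \<otimes> 1 - 1 \<otimes> P(X)\<close>
  (\<open>sum_deriv_mult_commutator\<close>), because along a monomial the left-hand side telescopes.

  Now let \<open>\<xi>\<^sub>i = [\<D>\<^sub>iV](X)\<close>. Since \<open>\<phi>(\<xi>\<^sub>i) = 0\<close>, subtracting \<open>1 \<otimes> P\<^sub>i(X)\<close> is invisible to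
  \<open>\<xi>\<^sub>i \<otimes> 1\<close>:
    \<open>\<phi>(\<xi>\<^sub>i P\<^sub>i(X)\<^sup>*) = (\<phi> \<otimes> \<phi>\<^sup>o\<^sup>p)((\<xi>\<^sub>i \<otimes> 1) (P\<^sub>i(X) \<otimes> 1 - 1 \<otimes> P\<^sub>i(X))\<^sup>*)\<close>.
  Substituting the difference quotient and moving \<open>T\<^sub>j\<^sup>* = T\<^sub>j\<close> to the left factor yields
  \<open>\<Sum>\<^sub>j (\<phi> \<otimes> \<phi>\<^sup>o\<^sup>p)((\<xi>\<^sub>i \<otimes> 1) T\<^sub>j [\<partial>\<^sub>jP\<^sub>i](X)\<^sup>*)\<close>, so that the matrix with entries
  \<open>(\<xi>\<^sub>i \<otimes> 1) T\<^sub>j\<close> represents a free Stein kernel.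
\<close>

section \<open>The algebra of bounded operators\<close>

lemma bop_apply_simps [simp]:
  "bop_apply (a * b) x = bop_apply a (bop_apply b x)"
  "bop_apply (a + b) x = bop_apply a x + bop_apply b x"
  "bop_apply (a - b) x = bop_apply a x - bop_apply b x"
  "bop_apply (c *\<^sub>C a) x = c *\<^sub>C bop_apply a x"
  by (transfer, simp)+

lemma bop_scaleC_mult:
  fixes a b :: "'h :: chilbert_space bop"
  shows "(c *\<^sub>C a) * b = c *\<^sub>C (a * b)" "a * (c *\<^sub>C b) = c *\<^sub>C (a * b)"
  by (rule bop_eqI, simp add: bop_scaleC)+

lemma cinner_diff:
  fixes x y z :: "'h :: chilbert_space"
  shows "cinner (x - y) z = cinner x z - cinner y z" "cinner z (x - y) = cinner z x - cinner z y"
proof -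
  show "cinner (x - y) z = cinner x z - cinner y z"
    using cinner_add_left[of "x - y" y z] by simp
  show "cinner z (x - y) = cinner z x - cinner z y"
    using cinner_add_right[of z "x - y" y] by simp
qed

lemma adj_adj [simp]: "adj (adj a) = a"
  by (rule adj_unique) (metis cinner_adj cinner_commute)

lemma adj_mult [simp]: "adj (a * b) = adj b * adj a"
  by (rule adj_unique) (simp add: cinner_adj)

lemma adj_one [simp]: "adj 1 = 1"
  by (rule adj_unique) simp

lemma adj_diff [simp]: "adj (a - b) = adj a - adj b"
  by (rule adj_unique) (simp add: cinner_diff cinner_adj)

lemma adj_add [simp]: "adj (a + b) = adj a + adj b"
  by (rule adj_unique) (simp add: cinner_add_left cinner_add_right cinner_adj)

lemma adj_zero [simp]: "adj 0 = 0"
  using adj_diff[of 0 0] by simp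

lemma adj_sum: "adj (sum f A) = (\<Sum>i\<in>A. adj (f i))"
  by (induction A rule: infinite_finite_induct) simp_all


section \<open>Commutants and von Neumann algebras\<close>

lemma commutant_one: "1 \<in> commutant S"
  and commutant_zero: "0 \<in> commutant S"
  by (simp_all add: commutant_def)

lemma commutant_iff: "b \<in> commutant S \<longleftrightarrow> (\<forall>a\<in>S. a * b = b * a)"
  by (simp add: commutant_def)

lemma commutant_add: "a \<in> commutant S \<Longrightarrow> b \<in> commutant S \<Longrightarrow> a + b \<in> commutant S"
  and commutant_diff: "a \<in> commutant S \<Longrightarrow> b \<in> commutant S \<Longrightarrow> a - b \<in> commutant S"
  and commutant_scaleC: "a \<in> commutant S \<Longrightarrow> c *\<^sub>C a \<in> commutant S"
  unfolding commutant_iff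
  by (simp_all add: distrib_left distrib_right left_diff_distrib right_diff_distrib
      bop_scaleC_mult)

lemma commutant_mult:
  assumes "a \<in> commutant S" "b \<in> commutant S"
  shows "a * b \<in> commutant S"
  unfolding commutant_iff
proof
  fix s assume s: "s \<in> S"
  have "s * (a * b) = (s * a) * b" by (simp only: mult.assoc)
  also have "s * a = a * s" using assms(1) s by (simp add: commutant_iff)
  also have "a * s * b = a * (s * b)" by (simp only: mult.assoc)
  also have "s * b = b * s" using assms(2) s by (simp add: commutant_iff)
  finally show "s * (a * b) = a * b * s" by (simp only: mult.assoc)
qed

lemma commutant_sum: "(\<And>i. i \<in> A \<Longrightarrow> f i \<in> commutant S) \<Longrightarrow> sum f A \<in> commutant S"
  by (induction A rule: infinite_finite_induct) (simp_all add: commutant_zero commutant_add)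

lemma subset_double_commutant: "S \<subseteq> commutant (commutant S)"
  by (auto simp: commutant_def)

lemma commutant_adj:
  assumes S: "\<And>s. s \<in> S \<Longrightarrow> adj s \<in> S" and a: "a \<in> commutant S"
  shows "adj a \<in> commutant S"
proof -
  have "s * adj a = adj a * s" if "s \<in> S" for s
  proof -
    have "adj (adj s * a) = adj (a * adj s)"
      using a S[OF that] by (simp add: commutant_def)
    thus ?thesis by simp
  qed
  thus ?thesis by (simp add: commutant_def)
qed

lemma von_neumann_algebraD:
  assumes "von_neumann_algebra M"
  shows "1 \<in> M" "a \<in> M \<Longrightarrow> b \<in> M \<Longrightarrow> a + b \<in> M" "a \<in> M \<Longrightarrow> c *\<^sub>C a \<in> M"
    "a \<in> M \<Longrightarrow> b \<in> M \<Longrightarrow> a * b \<in> M" "(\<And>i. i \<in> A \<Longrightarrow> f i \<in> M) \<Longrightarrow> sum f A \<in> M"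
    "a \<in> M \<Longrightarrow> adj a \<in> M"
proof -
  obtain S where S: "M = commutant S"
    using assms unfolding von_neumann_algebra_def by metis
  show "1 \<in> M" "a \<in> M \<Longrightarrow> b \<in> M \<Longrightarrow> a + b \<in> M" "a \<in> M \<Longrightarrow> c *\<^sub>C a \<in> M"
    "a \<in> M \<Longrightarrow> b \<in> M \<Longrightarrow> a * b \<in> M" "(\<And>i. i \<in> A \<Longrightarrow> f i \<in> M) \<Longrightarrow> sum f A \<in> M"
    unfolding S
    by (blast intro: commutant_one commutant_add commutant_scaleC commutant_mult commutant_sum)+
  show "a \<in> M \<Longrightarrow> adj a \<in> M"
    using assms by (simp add: von_neumann_algebra_def)
qed

text \<open>An anti-isomorphism is onto an algebra containing the identity, and the image of the identity
  acts there as a unit.\<close>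

lemma opposite_algebra_one:
  assumes M: "von_neumann_algebra M" and Mop: "opposite_algebra M \<rho> N"
  shows "\<rho> 1 = 1"
proof -
  have N: "1 \<in> N" and im: "\<rho> ` M = N"
    and mult: "\<And>a b. a \<in> M \<Longrightarrow> b \<in> M \<Longrightarrow> \<rho> (a * b) = \<rho> b * \<rho> a"
    using Mop von_neumann_algebraD(1)[of N] by (auto simp: opposite_algebra_def bij_betw_def)
  obtain e where e: "e \<in> M" "\<rho> e = 1"
    using N im by (metis imageE)
  show ?thesis
    using mult[OF e(1) von_neumann_algebraD(1)[OF M]] e(2) by simp
qed


section \<open>Elementary tensors of operators\<close>

lemma tensor_op_eqI:
  assumes "hilbert_tensor t"
    and "\<And>x y. bop_apply c (t x y) = t (bop_apply a x) (bop_apply b y)"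
  shows "tensor_op t a b = c"
  by (rule bop_eqI_tensor[OF assms(1)]) (simp add: tensor_op_apply[OF assms(1)] assms(2))

lemma tensor_op_mult:
  assumes "hilbert_tensor t"
  shows "tensor_op t a b * tensor_op t a' b' = tensor_op t (a * a') (b * b')"
  by (rule tensor_op_eqI[OF assms, symmetric]) (simp add: tensor_op_apply[OF assms])

lemma tensor_op_add:
  assumes "hilbert_tensor t"
  shows "tensor_op t (a + a') b = tensor_op t a b + tensor_op t a' b"
    "tensor_op t a (b + b') = tensor_op t a b + tensor_op t a b'"
  by (rule tensor_op_eqI[OF assms],
      simp add: tensor_op_apply[OF assms] hilbert_tensorD(1,2)[OF assms])+

lemma tensor_op_scaleC:
  assumes "hilbert_tensor t"
  shows "tensor_op t (c *\<^sub>C a) b = c *\<^sub>C tensor_op t a b"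
    "tensor_op t a (c *\<^sub>C b) = c *\<^sub>C tensor_op t a b"
  by (rule tensor_op_eqI[OF assms],
      simp add: tensor_op_apply[OF assms] hilbert_tensorD(3,4)[OF assms])+

text \<open>The elementary tensors span a dense subspace, so a vector is determined by its inner products
  with them.\<close>

lemma tensor_vector_eqI:
  assumes t: "hilbert_tensor t" and eq: "\<And>x y. cinner (t x y) u = cinner (t x y) v"
  shows "u = v"
proof -
  let ?Z = "{z. inner z (u - v) = 0}"
  have "closed ?Z"
    by (intro closed_Collect_eq continuous_intros)
  moreover have "span (range (\<lambda>(x, y). t x y)) \<subseteq> ?Z"
  proof (rule span_minimal)
    show "range (\<lambda>(x, y). t x y) \<subseteq> ?Z"
      using eq by (auto simp: inner_cinner cinner_diff)
    show "subspace ?Z"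
      by (auto simp: subspace_def inner_add_left)
  qed
  ultimately have "closure (span (range (\<lambda>(x, y). t x y))) \<subseteq> ?Z"
    by (rule closure_minimal[rotated])
  hence "u - v \<in> ?Z" unfolding hilbert_tensorD(6)[OF t] by (rule subsetD) (rule UNIV_I)
  thus ?thesis by simp
qed

lemma adj_tensor_op:
  assumes t: "hilbert_tensor t"
  shows "adj (tensor_op t a b) = tensor_op t (adj a) (adj b)"
proof (rule tensor_op_eqI[OF t, symmetric], rule tensor_vector_eqI[OF t])
  fix x y x' y'
  show "cinner (t x' y') (bop_apply (adj (tensor_op t a b)) (t x y)) =
      cinner (t x' y') (t (bop_apply (adj a) x) (bop_apply (adj b) y))"
    by (simp add: cinner_adj[symmetric] tensor_op_apply[OF t] hilbert_tensorD(5)[OF t])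
qed

lemma tensor_op_in_vn_tensor: "a \<in> M \<Longrightarrow> b \<in> N \<Longrightarrow> tensor_op t a b \<in> vn_tensor t M N"
  unfolding vn_tensor_def by (rule subsetD[OF subset_double_commutant]) auto

lemma vn_tensor_closed:
  shows "a \<in> vn_tensor t M N \<Longrightarrow> b \<in> vn_tensor t M N \<Longrightarrow> a + b \<in> vn_tensor t M N"
    "a \<in> vn_tensor t M N \<Longrightarrow> b \<in> vn_tensor t M N \<Longrightarrow> a - b \<in> vn_tensor t M N"
    "a \<in> vn_tensor t M N \<Longrightarrow> b \<in> vn_tensor t M N \<Longrightarrow> a * b \<in> vn_tensor t M N"
    "a \<in> vn_tensor t M N \<Longrightarrow> c *\<^sub>C a \<in> vn_tensor t M N"
    "(\<And>i. i \<in> A \<Longrightarrow> f i \<in> vn_tensor t M N) \<Longrightarrow> sum f A \<in> vn_tensor t M N"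
  unfolding vn_tensor_def
  by (fact commutant_add commutant_diff commutant_mult commutant_scaleC commutant_sum)+

lemma vn_tensor_adj:
  assumes "hilbert_tensor t" "von_neumann_algebra M" "von_neumann_algebra N"
    and "a \<in> vn_tensor t M N"
  shows "adj a \<in> vn_tensor t M N"
proof -
  let ?S = "{tensor_op t a b | a b. a \<in> M \<and> b \<in> N}"
  have "adj s \<in> ?S" if "s \<in> ?S" for s
    using that von_neumann_algebraD(6)[OF assms(2)] von_neumann_algebraD(6)[OF assms(3)]
    by (auto simp: adj_tensor_op[OF assms(1)]) blast
  hence "adj s \<in> commutant ?S" if "s \<in> commutant ?S" for s
    using commutant_adj[of ?S s] that by simp
  thus ?thesis
    using commutant_adj[of "commutant ?S" a] assms(4) unfolding vn_tensor_def by simp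
qed

lemma state_on_sum:
  assumes "state_on W \<psi>" "0 \<in> W" "\<And>a b. a \<in> W \<Longrightarrow> b \<in> W \<Longrightarrow> a + b \<in> W"
    and "finite A" "\<And>i. i \<in> A \<Longrightarrow> f i \<in> W"
  shows "\<psi> (sum f A) = (\<Sum>i\<in>A. \<psi> (f i))"
proof -
  have add: "\<And>a b. a \<in> W \<Longrightarrow> b \<in> W \<Longrightarrow> \<psi> (a + b) = \<psi> a + \<psi> b"
    using assms(1) unfolding state_on_def by blast
  have "\<psi> 0 = 0" using add[OF assms(2,2)] by simp
  with assms(4,5) have "\<psi> (sum f A) = (\<Sum>i\<in>A. \<psi> (f i)) \<and> sum f A \<in> W"
    by (induction A rule: finite_induct) (simp_all add: add assms(2,3))
  thus ?thesis ..
qed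


section \<open>The noncommutative difference quotient\<close>

lemma nc_deriv_eq_word_deriv: "nc_deriv i = lin_ext (word_deriv i)"
  by (rule ex1E[OF nc_deriv_ex1[of i]]) (metis is_nc_deriv_nc_deriv is_nc_deriv_word_deriv)

lemma lin_ext_mem:
  assumes "0 \<in> W" "\<And>a b. a \<in> W \<Longrightarrow> b \<in> W \<Longrightarrow> a + b \<in> W" "\<And>c a. a \<in> W \<Longrightarrow> c *\<^sub>C a \<in> W"
    and "\<And>w. f w \<in> W"
  shows "lin_ext f P \<in> W"
proof -
  have "(\<Sum>w\<in>K. Poly_Mapping.lookup P w *\<^sub>C f w) \<in> W" if "finite K" for K
    using that by (induction K rule: finite_induct) (simp_all add: assms)
  thus ?thesis by (simp add: lin_ext_def)
qed

lemma eval_word_mem: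
  assumes "von_neumann_algebra M" "\<And>i. X $ i \<in> M"
  shows "eval_word X w \<in> M"
  by (induction w) (simp_all add: eval_word_def assms von_neumann_algebraD[OF assms(1)])

lemma nc_eval_mem:
  assumes "von_neumann_algebra M" "\<And>i. X $ i \<in> M"
  shows "nc_eval X P \<in> M"
  unfolding nc_eval_def
  using von_neumann_algebraD(5)[OF assms(1), of "{}"]
  by (intro lin_ext_mem von_neumann_algebraD(2,3)[OF assms(1)] eval_word_mem[OF assms]) simp_all

lemma nc_eval2_mem:
  assumes M: "von_neumann_algebra M" and Mop: "opposite_algebra M \<rho> N" and X: "\<And>i. X $ i \<in> M"
  shows "nc_eval2 t \<rho> X U \<in> vn_tensor t M N"
proof -
  have "\<rho> a \<in> N" if "a \<in> M" for a
    using Mop that by (auto simp: opposite_algebra_def bij_betw_def)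
  thus ?thesis
    unfolding nc_eval2_def using vn_tensor_closed(5)[of "{}"]
    by (intro lin_ext_mem)
      (auto simp: vn_tensor_closed intro!: tensor_op_in_vn_tensor eval_word_mem[OF M X])
qed

lemma nc_eval2_left_mult:
  assumes t: "hilbert_tensor t"
  shows "nc_eval2 t \<rho> X (Poly_Mapping.single ([i], []) 1 * U) =
    tensor_op t (X $ i) 1 * nc_eval2 t \<rho> X U"
proof -
  note E = lin_ext_clinear[of "\<lambda>(u, v). tensor_op t (eval_word X u) (\<rho> (eval_word X v))",
      folded nc_eval2_def, unfolded clinear_map_def, rule_format]
  show ?thesis
    by (rule clinear_eqI[of "\<lambda>U. nc_eval2 t \<rho> X (Poly_Mapping.single ([i], []) 1 * U)"
          "\<lambda>U. tensor_op t (X $ i) 1 * nc_eval2 t \<rho> X U"])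
      (auto simp: clinear_map_def distrib_left scaleC_mult_right bop_scaleC_mult E,
        auto simp: nc_eval2_def mult_single plus_list_def scaleC_one tensor_op_mult[OF t]
          eval_word_def)
qed

text \<open>Prepending a letter \<open>k\<close> to a word \<open>w\<close> adds to the left-hand side the term
  \<open>(1 \<otimes> w) T\<^sub>k = x\<^sub>k \<otimes> w - 1 \<otimes> x\<^sub>k w\<close> and multiplies the remaining ones by \<open>x\<^sub>k \<otimes> 1\<close>; the terms
  \<open>x\<^sub>k \<otimes> w\<close> then cancel.\<close>

lemma sum_word_deriv_mult_commutator:
  assumes M: "von_neumann_algebra M" and Mop: "opposite_algebra M \<rho> N"
    and t: "hilbert_tensor t" and X: "\<And>i. X $ i \<in> M"
  shows "(\<Sum>j\<in>UNIV. nc_eval2 t \<rho> X (word_deriv j w) *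
      (tensor_op t (X $ j) 1 - tensor_op t 1 (\<rho> (X $ j)))) =
    tensor_op t (eval_word X w) 1 - tensor_op t 1 (\<rho> (eval_word X w))"
proof (induction w)
  case Nil
  show ?case
    by (simp add: eval_word_def opposite_algebra_one[OF M Mop] nc_eval2_def
        clinear_zero[OF lin_ext_clinear])
next
  case (Cons k w)
  let ?T = "\<lambda>j. tensor_op t (X $ j) 1 - tensor_op t 1 (\<rho> (X $ j))"
  let ?E = "nc_eval2 t \<rho> X" and ?w = "eval_word X w"
  have E_add: "?E (U + U') = ?E U + ?E U'" for U U'
    using lin_ext_clinear unfolding nc_eval2_def clinear_map_def by blast
  have E0: "?E 0 = 0"
    by (simp add: nc_eval2_def clinear_zero[OF lin_ext_clinear])
  have E1: "?E (Poly_Mapping.single ([], w) 1) = tensor_op t 1 (\<rho> ?w)"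
    by (simp add: nc_eval2_def scaleC_one) (simp add: eval_word_def)
  have \<rho>: "\<rho> (X $ k * ?w) = \<rho> ?w * \<rho> (X $ k)"
    using Mop X eval_word_mem[OF M X] unfolding opposite_algebra_def by blast
  have "(\<Sum>j\<in>UNIV. ?E (word_deriv j (k # w)) * ?T j) =
      (\<Sum>j\<in>UNIV. (if j = k then tensor_op t 1 (\<rho> ?w) * ?T k else 0)) +
      tensor_op t (X $ k) 1 * (\<Sum>j\<in>UNIV. ?E (word_deriv j w) * ?T j)"
    unfolding sum_distrib_left sum.distrib[symmetric]
    by (intro sum.cong refl)
      (simp add: E_add E0 E1 nc_eval2_left_mult[OF t] distrib_right mult.assoc)
  also have "\<dots> = tensor_op t 1 (\<rho> ?w) * ?T k +
      tensor_op t (X $ k) 1 * (tensor_op t ?w 1 - tensor_op t 1 (\<rho> ?w))"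
    unfolding Cons.IH by simp
  also have "\<dots> = tensor_op t (X $ k * ?w) 1 - tensor_op t 1 (\<rho> (X $ k * ?w))"
    by (simp add: right_diff_distrib tensor_op_mult[OF t] \<rho>)
  finally show ?case by (simp add: eval_word_def)
qed

lemma sum_deriv_mult_commutator:
  fixes X :: "'h :: chilbert_space bop ^ 'n :: finite"
  assumes M: "von_neumann_algebra M" and Mop: "opposite_algebra M \<rho> N"
    and t: "hilbert_tensor t" and X: "\<And>i. X $ i \<in> M"
  shows "(\<Sum>j\<in>UNIV. nc_eval2 t \<rho> X (nc_deriv j P) *
      (tensor_op t (X $ j) 1 - tensor_op t 1 (\<rho> (X $ j)))) =
    tensor_op t (nc_eval X P) 1 - tensor_op t 1 (\<rho> (nc_eval X P))"
proof -
  let ?T = "\<lambda>j. tensor_op t (X $ j) 1 - tensor_op t 1 (\<rho> (X $ j))"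
  note lin = lin_ext_clinear[unfolded clinear_map_def, rule_format]
  have \<rho>: "\<rho> (nc_eval X P + nc_eval X Q) = \<rho> (nc_eval X P) + \<rho> (nc_eval X Q)"
    "\<rho> (c *\<^sub>C nc_eval X P) = c *\<^sub>C \<rho> (nc_eval X P)" for P Q c
    using Mop nc_eval_mem[OF M X] unfolding opposite_algebra_def by blast+
  have ev: "nc_eval X (P + Q) = nc_eval X P + nc_eval X Q"
    "nc_eval X (c *\<^sub>C P) = c *\<^sub>C nc_eval X P" for P Q c
    by (simp_all add: nc_eval_def lin)
  have ev2: "nc_eval2 t \<rho> X (U + U') = nc_eval2 t \<rho> X U + nc_eval2 t \<rho> X U'"
    "nc_eval2 t \<rho> X (c *\<^sub>C U) = c *\<^sub>C nc_eval2 t \<rho> X U" for U U' c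
    by (simp_all add: nc_eval2_def lin)
  have d: "nc_deriv j (P + Q) = nc_deriv j P + nc_deriv j Q"
    "nc_deriv j (c *\<^sub>C P) = c *\<^sub>C nc_deriv j P"
    "nc_deriv j (Poly_Mapping.single w 1) = word_deriv j w" for j :: 'n and P Q c w
    by (simp_all add: nc_deriv_eq_word_deriv lin scaleC_one)
  have L: "clinear_map (\<lambda>P. \<Sum>j\<in>UNIV. nc_eval2 t \<rho> X (nc_deriv j P) * ?T j)"
    by (simp add: clinear_map_def d ev2 distrib_right sum.distrib bop_scaleC_mult scaleC_sum_right)
  have R: "clinear_map (\<lambda>P. tensor_op t (nc_eval X P) 1 - tensor_op t 1 (\<rho> (nc_eval X P)))"
    by (simp add: clinear_map_def ev \<rho> tensor_op_add[OF t] tensor_op_scaleC[OF t] scaleC_diff_right)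
  show ?thesis
    by (rule clinear_eqI[OF L R])
      (simp add: d sum_word_deriv_mult_commutator[OF M Mop t X] nc_eval_def scaleC_one)
qed


section \<open>Existence of free Stein kernels\<close>

text \<open>For centred \<open>\<xi>\<close>, subtracting the second leg does not change the inner product with
  \<open>\<xi> \<otimes> 1\<close>, since that leg contributes the factor \<open>\<phi>(\<xi>) = 0\<close>.\<close>

lemma product_state_centred:
  assumes M: "von_neumann_algebra M" and \<phi>: "state_on M \<phi>" and Mop: "opposite_algebra M \<rho> N"
    and t: "hilbert_tensor t" and \<psi>: "product_state t M \<phi> \<rho> N \<psi>"
    and \<xi>: "\<xi> \<in> M" "\<phi> \<xi> = 0" and p: "p \<in> M"
  shows "\<psi> (tensor_op t \<xi> 1 * adj (tensor_op t p 1 - tensor_op t 1 (\<rho> p))) = \<phi> (\<xi> * adj p)"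
proof -
  note M' = von_neumann_algebraD[OF M]
  let ?W = "vn_tensor t M N"
  have N: "\<rho> a \<in> N" if "a \<in> M" for a
    using Mop that by (auto simp: opposite_algebra_def bij_betw_def)
  have one: "\<rho> 1 = 1" by (rule opposite_algebra_one[OF M Mop])
  have ps: "\<psi> (tensor_op t a (\<rho> b)) = \<phi> a * \<phi> b" if "a \<in> M" "b \<in> M" for a b
    using \<psi> that by (simp add: product_state_def)
  have \<psi>_add: "\<psi> (a + b) = \<psi> a + \<psi> b" if "a \<in> ?W" "b \<in> ?W" for a b
    using \<psi> that by (auto simp: product_state_def state_on_def)
  let ?a = "tensor_op t (\<xi> * adj p) (\<rho> 1)" and ?b = "tensor_op t \<xi> (\<rho> (adj p))"
  have ab: "?a \<in> ?W" "?b \<in> ?W"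
    using \<xi> p by (auto intro!: tensor_op_in_vn_tensor N M')
  have "\<rho> (adj p) = adj (\<rho> p)" using Mop p by (simp add: opposite_algebra_def)
  hence "tensor_op t \<xi> 1 * adj (tensor_op t p 1 - tensor_op t 1 (\<rho> p)) = ?a - ?b"
    by (simp add: adj_tensor_op[OF t] right_diff_distrib tensor_op_mult[OF t] one)
  moreover have "\<psi> (?a - ?b) = \<psi> ?a - \<psi> ?b"
    using \<psi>_add[OF vn_tensor_closed(2)[OF ab] ab(2)] by simp
  moreover have "\<phi> 1 = 1" using \<phi> by (simp add: state_on_def)
  ultimately show ?thesis
    using \<xi> p by (simp add: ps M')
qed

theorem theorem1p2:
  fixes M :: "'h :: chilbert_space bop set"
    and \<phi> :: "'h bop \<Rightarrow> complex"
    and N :: "'g :: chilbert_space bop set"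
    and \<rho> :: "'h bop \<Rightarrow> 'g bop"
    and t :: "'h \<Rightarrow> 'g \<Rightarrow> 'k :: chilbert_space"
    and \<psi> :: "'k bop \<Rightarrow> complex"
    and \<iota> :: "'k bop ^ 'n :: finite ^ 'n \<Rightarrow> 'l :: chilbert_space"
    and V :: "'n ncpoly"
    and X :: "'h bop ^ 'n"
  assumes M: "von_neumann_algebra M"
    and \<phi>: "state_on M \<phi>" "normal_on M \<phi>" "faithful_on M \<phi>"
    and Mop: "opposite_algebra M \<rho> N"
    and tensor: "hilbert_tensor t"
    and \<psi>: "product_state t M \<phi> \<rho> N \<psi>"
    and L2: "L2_completion (vn_tensor t M N) \<psi> \<iota>"
    and X: "\<And>i. X $ i \<in> M" "\<And>i. adj (X $ i) = X $ i"
    and V: "\<And>i. \<phi> (nc_eval_tuple X (cyc_grad V) $ i) = 0"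
  shows "\<exists>A :: 'l. free_stein_kernel t \<rho> \<phi> \<iota> X V A"
proof -
  let ?W = "vn_tensor t M N"
  define \<xi> where "\<xi> i = nc_eval X (cyc_grad V $ i)" for i
  define T where "T j = tensor_op t (X $ j) 1 - tensor_op t 1 (\<rho> (X $ j))" for j
  define K :: "'k bop ^ 'n ^ 'n" where "K = (\<chi> i j. tensor_op t (\<xi> i) 1 * T j)"
  note M' = von_neumann_algebraD[OF M]
  have N: "von_neumann_algebra N" "\<And>a. a \<in> M \<Longrightarrow> \<rho> a \<in> N"
    using Mop by (auto simp: opposite_algebra_def bij_betw_def)
  have N1: "1 \<in> N" by (rule von_neumann_algebraD(1)[OF N(1)])
  have \<xi>: "\<xi> i \<in> M" "\<phi> (\<xi> i) = 0" for i
    using nc_eval_mem[OF M X(1)] V[of i] by (simp_all add: \<xi>_def nc_eval_tuple_def)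
  have T_mem: "T j \<in> ?W" for j
    unfolding T_def by (intro vn_tensor_closed tensor_op_in_vn_tensor N X M' N1)
  have T_adj: "adj (T j) = T j" for j
  proof -
    have "adj (\<rho> (X $ j)) = \<rho> (X $ j)"
      using Mop X[of j] unfolding opposite_algebra_def by metis
    thus ?thesis by (simp add: T_def adj_tensor_op[OF tensor] X(2))
  qed
  have K_mem: "K \<in> matrices_over ?W"
    by (auto simp: matrices_over_def K_def
        intro!: vn_tensor_closed T_mem tensor_op_in_vn_tensor \<xi> N1)
  have row: "(\<Sum>j\<in>UNIV. \<psi> (K $ i $ j * adj (nc_eval2 t \<rho> X (nc_deriv j P)))) =
      \<phi> (\<xi> i * adj (nc_eval X P))" for i P
  proof -
    let ?J = "\<lambda>j. nc_eval2 t \<rho> X (nc_deriv j P)"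
    have KJ: "K $ i $ j * adj (?J j) \<in> ?W" for j
      using K_mem
      by (auto simp: matrices_over_def
          intro!: vn_tensor_closed(3) vn_tensor_adj[OF tensor M N(1)] nc_eval2_mem[OF M Mop X(1)])
    have "(\<Sum>j\<in>UNIV. \<psi> (K $ i $ j * adj (?J j))) = \<psi> (\<Sum>j\<in>UNIV. K $ i $ j * adj (?J j))"
      using \<psi> vn_tensor_closed(5)[of "{}"]
      by (intro state_on_sum[symmetric, of ?W])
        (auto simp: product_state_def vn_tensor_closed KJ)
    also have "(\<Sum>j\<in>UNIV. K $ i $ j * adj (?J j)) =
        tensor_op t (\<xi> i) 1 * adj (\<Sum>j\<in>UNIV. ?J j * T j)"
      by (simp add: K_def adj_sum T_adj sum_distrib_left mult.assoc)
    also have "\<psi> \<dots> = \<phi> (\<xi> i * adj (nc_eval X P))"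
      unfolding T_def sum_deriv_mult_commutator[OF M Mop tensor X(1)]
      by (rule product_state_centred[OF M \<phi>(1) Mop tensor \<psi> \<xi> nc_eval_mem[OF M X(1)]])
    finally show ?thesis .
  qed
  have "free_stein_kernel t \<rho> \<phi> \<iota> X V (\<iota> K)"
    unfolding free_stein_kernel_def
  proof
    fix P :: "'n ncpoly ^ 'n"
    let ?J = "nc_eval2_mat t \<rho> X (nc_jacobian P)"
    have J_mem: "?J \<in> matrices_over ?W"
      by (simp add: matrices_over_def nc_eval2_mat_def nc_eval2_mem[OF M Mop X(1)])
    have "cinner (\<iota> K) (\<iota> ?J) = mat_inner \<psi> K ?J"
      using L2 K_mem J_mem by (simp add: L2_completion_def)
    also have "\<dots> = (\<Sum>i\<in>UNIV. \<phi> (\<xi> i * adj (nc_eval X (P $ i))))"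
      by (simp add: mat_inner_def nc_eval2_mat_def nc_jacobian_def row)
    also have "\<dots> = tuple_inner \<phi> (nc_eval_tuple X (cyc_grad V)) (nc_eval_tuple X P)"
      by (simp add: tuple_inner_def nc_eval_tuple_def \<xi>_def)
    finally show "tuple_inner \<phi> (nc_eval_tuple X (cyc_grad V)) (nc_eval_tuple X P) =
        cinner (\<iota> K) (\<iota> ?J)" by (rule sym)
  qed
  thus ?thesis ..
qed

end
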